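(* For every $b\in(0,1]$ and $\rho_{\mathrm{CSGE}}\in\mathbb{R}$ there is a constant $c>0$ depending only on $b$ and $\rho_{\mathrm{CSGE}}$ such that the following holds. Let $\mu$ be a probability distribution supported on $\Omega=\{\pm1\}^n$ and $\{q_i:\Omega\to\mathbb{R}_+\}_{i\in[n]}$ be transition rates reversible for $\mu$. Let $\{w_i:\Omega\to\mathbb{R}_+\}_{i\in[n]}$ be $b$-bounded weight functions. Assume both $0$-CSGE and $\infty$-CSGE hold with constant $\rho_{\mathrm{CSGE}}$, and the log-Sobolev inequality holds with constant $\rho_{\mathrm{LSI}}>0$. Then for any $f:\Omega\to\{\pm1\}$, $$A_w(f)\ge c\,\frac{\sqrt{\rho_{\mathrm{LSI}}}\,\min\{1,\rho_{\mathrm{LSI}}\}}{\sqrt{1+\log_+(1/\rho_{\mathrm{LSI}})}}\;\mathrm{Var}_\mu(f)\sqrt{\log\left(1+\frac{e}{J_w(f)}\right)}.$$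
   Context: $x^i$ is $x\in\Omega$ with the $i$-th coordinate flipped. Generator: $Lf(x)=\sum_{i=1}^nq_i(x)(f(x^i)-f(x))$; $P_t=e^{tL}$. Reversible for $\mu$: $\mu(x)q_i(x)=\mu(x^i)q_i(x^i)$ for all $x,i$. $b$-bounded weights: $b\le w_i(x)\le1/b$ for all $x,i$. $\delta_{w,i}f(x)=\sqrt{\frac12w_i(x)q_i(x)}\,(f(x^i)-f(x))$; $\nabla_wf=(\delta_{w,1}f,\dots,\delta_{w,n}f)$; $|\nabla_w|f=(|\delta_{w,1}f|,\dots,|\delta_{w,n}f|)$. $A_w(f)=\mathbb{E}_\mu[\|\nabla_wf\|_2]$; $J_w(f)=\sum_{i=1}^n(\mathbb{E}_\mu[|\delta_{w,i}f|])^2$. $\Gamma(f)(x)=\frac12\sum_iq_i(x)(f(x^i)-f(x))^2$. $0$-CSGE with constant $\rho$: for all $f:\Omega\to\mathbb{R}$, $t\ge0$, pointwise, $\|\nabla_wP_tf\|_2\le e^{-\rho t}\|P_t|\nabla_w|f\|_2$ ($P_t$ acts entrywise on vector fields). $\infty$-CSGE with constant $\rho$: for all $f:\Omega\to\mathbb{R}$, $t\ge0$, $\|\mathbb{E}_\mu[|\nabla_w|P_tf]\|_2\le e^{-\rho t}\|\mathbb{E}_\mu[|\nabla_w|f]\|_2$. Log-Sobolev inequality with constant $\rho$: $\mathrm{Ent}_\mu[f^2]\le\frac2\rho\mathbb{E}_\mu[\Gamma(f)]$ for all $f:\Omega\to\mathbb{R}$, where $\mathrm{Ent}_\mu[g]=\mathbb{E}_\mu[g\log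 g]-\mathbb{E}_\mu[g]\log\mathbb{E}_\mu[g]$. $\log$ is natural, $\log_+(x)=\max\{\log x,0\}$. The right-hand side of the conclusion is $0$ when $\mathrm{Var}_\mu(f)=0$. *)

theory Defs
  imports "HOL-Probability.Probability"
begin

text \<open>
  The dimension \<open>n\<close> is quantified inside the scope of the constant \<open>c\<close>, so it cannot be a type.
  The cube lives on an explicit carrier, functions on it are total functions of which only the
  values on the carrier matter, and a vector field is a map from coordinates to functions.
\<close>

type_synonym point = "nat \<Rightarrow> int"
type_synonym vfield = "nat \<Rightarrow> point \<Rightarrow> real"

definition cube :: "nat \<Rightarrow> point set" where
  "cube n = {1..n} \<rightarrow>\<^sub>E {-1, 1}"

definition flip :: "nat \<Rightarrow> point \<Rightarrow> point" where
  "flip i x = x(i := - x i)"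

definition distribution_on_cube :: "nat \<Rightarrow> point pmf \<Rightarrow> bool" where
  "distribution_on_cube n \<mu> \<longleftrightarrow> set_pmf \<mu> \<subseteq> cube n"

definition transition_rates :: "nat \<Rightarrow> vfield \<Rightarrow> bool" where
  "transition_rates n q \<longleftrightarrow> (\<forall>i\<in>{1..n}. \<forall>x\<in>cube n. 0 \<le> q i x)"

definition reversible :: "nat \<Rightarrow> point pmf \<Rightarrow> vfield \<Rightarrow> bool" where
  "reversible n \<mu> q \<longleftrightarrow>
     (\<forall>i\<in>{1..n}. \<forall>x\<in>cube n. pmf \<mu> x * q i x = pmf \<mu> (flip i x) * q i (flip i x))"

definition bounded_weights :: "nat \<Rightarrow> real \<Rightarrow> vfield \<Rightarrow> bool" where
  "bounded_weights n b w \<longleftrightarrow> (\<forall>i\<in>{1..n}. \<forall>x\<in>cube n. b \<le> w i x \<and> w i x \<le> 1 / b)"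

definition generator :: "nat \<Rightarrow> vfield \<Rightarrow> (point \<Rightarrow> real) \<Rightarrow> point \<Rightarrow> real" where
  "generator n q f x = (\<Sum>i=1..n. q i x * (f (flip i x) - f x))"

text \<open>
  \<open>e\<^sup>t\<^sup>L\<close> as the exponential series, evaluated pointwise; it converges on the cube, see
  \<open>summable_semigroup\<close> below.
\<close>

definition semigroup :: "nat \<Rightarrow> vfield \<Rightarrow> real \<Rightarrow> (point \<Rightarrow> real) \<Rightarrow> point \<Rightarrow> real" where
  "semigroup n q t f x = (\<Sum>k. t ^ k / fact k * (generator n q ^^ k) f x)"

definition grad :: "vfield \<Rightarrow> vfield \<Rightarrow> (point \<Rightarrow> real) \<Rightarrow> vfield" where
  "grad q w f i x = sqrt (1 / 2 * w i x * q i x) * (f (flip i x) - f x)"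

definition abs_grad :: "vfield \<Rightarrow> vfield \<Rightarrow> (point \<Rightarrow> real) \<Rightarrow> vfield" where
  "abs_grad q w f i x = \<bar>grad q w f i x\<bar>"

definition A_fun :: "nat \<Rightarrow> point pmf \<Rightarrow> vfield \<Rightarrow> vfield \<Rightarrow> (point \<Rightarrow> real) \<Rightarrow> real" where
  "A_fun n \<mu> q w f = measure_pmf.expectation \<mu> (\<lambda>x. L2_set (\<lambda>i. grad q w f i x) {1..n})"

definition J_fun :: "nat \<Rightarrow> point pmf \<Rightarrow> vfield \<Rightarrow> vfield \<Rightarrow> (point \<Rightarrow> real) \<Rightarrow> real" where
  "J_fun n \<mu> q w f = (\<Sum>i=1..n. (measure_pmf.expectation \<mu> (\<lambda>x. \<bar>grad q w f i x\<bar>))\<^sup>2)"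

definition Gamma_op :: "nat \<Rightarrow> vfield \<Rightarrow> (point \<Rightarrow> real) \<Rightarrow> point \<Rightarrow> real" where
  "Gamma_op n q f x = 1 / 2 * (\<Sum>i=1..n. q i x * (f (flip i x) - f x)\<^sup>2)"

definition CSGE_0 :: "nat \<Rightarrow> vfield \<Rightarrow> vfield \<Rightarrow> real \<Rightarrow> bool" where
  "CSGE_0 n q w \<rho> \<longleftrightarrow> (\<forall>f. \<forall>t\<ge>0. \<forall>x\<in>cube n.
     L2_set (\<lambda>i. grad q w (semigroup n q t f) i x) {1..n}
       \<le> exp (- \<rho> * t) * L2_set (\<lambda>i. semigroup n q t (abs_grad q w f i) x) {1..n})"

definition CSGE_inf :: "nat \<Rightarrow> point pmf \<Rightarrow> vfield \<Rightarrow> vfield \<Rightarrow> real \<Rightarrow> bool" where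
  "CSGE_inf n \<mu> q w \<rho> \<longleftrightarrow> (\<forall>f. \<forall>t\<ge>0.
     L2_set (\<lambda>i. measure_pmf.expectation \<mu> (abs_grad q w (semigroup n q t f) i)) {1..n}
       \<le> exp (- \<rho> * t) * L2_set (\<lambda>i. measure_pmf.expectation \<mu> (abs_grad q w f i)) {1..n})"

text \<open>The convention \<open>0 log 0 = 0\<close> holds automatically.\<close>

definition Ent :: "point pmf \<Rightarrow> (point \<Rightarrow> real) \<Rightarrow> real" where
  "Ent \<mu> g = measure_pmf.expectation \<mu> (\<lambda>x. g x * ln (g x))
     - measure_pmf.expectation \<mu> g * ln (measure_pmf.expectation \<mu> g)"

definition log_sobolev :: "nat \<Rightarrow> point pmf \<Rightarrow> vfield \<Rightarrow> real \<Rightarrow> bool" where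
  "log_sobolev n \<mu> q \<rho> \<longleftrightarrow>
     (\<forall>f. Ent \<mu> (\<lambda>x. (f x)\<^sup>2) \<le> 2 / \<rho> * measure_pmf.expectation \<mu> (Gamma_op n q f))"

definition log_plus :: "real \<Rightarrow> real" where
  "log_plus x = max (ln x) 0"

lemma finite_cube: "finite (cube n)"
  unfolding cube_def by (rule finite_PiE) auto

lemma flip_in_cube: "x \<in> cube n \<Longrightarrow> i \<in> {1..n} \<Longrightarrow> flip i x \<in> cube n"
  unfolding cube_def flip_def by (auto simp: PiE_iff extensional_def)

lemma summable_semigroup:
  assumes "x \<in> cube n"
  shows "summable (\<lambda>k. t ^ k / fact k * (generator n q ^^ k) f x)"
proof -
  define Q where "Q = (\<Sum>y\<in>cube n. \<Sum>i=1..n. \<bar>q i y\<bar>)"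
  define M where "M = (\<Sum>y\<in>cube n. \<bar>f y\<bar>)"
  have Q0: "Q \<ge> 0" and M0: "M \<ge> 0"
    unfolding Q_def M_def by (auto intro!: sum_nonneg)
  have QB: "(\<Sum>i=1..n. \<bar>q i y\<bar>) \<le> Q" if "y \<in> cube n" for y
    unfolding Q_def using that finite_cube by (intro member_le_sum) (auto intro: sum_nonneg)
  have B: "\<bar>(generator n q ^^ k) f y\<bar> \<le> (2 * Q) ^ k * M" if "y \<in> cube n" for k y
    using that
  proof (induction k arbitrary: y)
    case 0
    show ?case unfolding M_def using 0 finite_cube
      by (auto intro: member_le_sum[where f = "\<lambda>y. \<bar>f y\<bar>"])
  next
    case (Suc k)
    let ?g = "(generator n q ^^ k) f" and ?C = "(2 * Q) ^ k * M"
    have "\<bar>(generator n q ^^ Suc k) f y\<bar> \<le> (\<Sum>i=1..n. \<bar>q i y * (?g (flip i y) - ?g y)\<bar>)"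
      by (simp add: generator_def sum_abs)
    also have "\<dots> \<le> (\<Sum>i=1..n. \<bar>q i y\<bar> * (2 * ?C))"
    proof (rule sum_mono)
      fix i assume i: "i \<in> {1..n}"
      have "\<bar>?g (flip i y) - ?g y\<bar> \<le> 2 * ?C"
        using Suc.IH[OF Suc.prems] Suc.IH[OF flip_in_cube[OF Suc.prems i]] by linarith
      then show "\<bar>q i y * (?g (flip i y) - ?g y)\<bar> \<le> \<bar>q i y\<bar> * (2 * ?C)"
        by (simp add: abs_mult mult_left_mono)
    qed
    also have "\<dots> = (\<Sum>i=1..n. \<bar>q i y\<bar>) * (2 * ?C)" by (simp add: sum_distrib_right)
    also have "\<dots> \<le> Q * (2 * ?C)"
      using QB[OF Suc.prems] Q0 M0 by (intro mult_right_mono) auto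
    finally show ?case by (simp add: mult_ac)
  qed
  have "summable (\<lambda>k. M * (inverse (fact k) * (\<bar>t\<bar> * (2 * Q)) ^ k))"
    by (intro summable_mult summable_exp)
  then show ?thesis
  proof (rule summable_comparison_test')
    fix k assume "k \<ge> (0::nat)"
    have "norm (t ^ k / fact k * (generator n q ^^ k) f x)
        \<le> \<bar>t\<bar> ^ k / fact k * ((2 * Q) ^ k * M)"
      unfolding real_norm_def abs_mult abs_divide power_abs abs_of_nonneg[OF fact_ge_zero]
      by (intro mult_left_mono B[OF assms]) auto
    then show "norm (t ^ k / fact k * (generator n q ^^ k) f x)
        \<le> M * (inverse (fact k) * (\<bar>t\<bar> * (2 * Q)) ^ k)"
      by (simp add: field_simps power_mult_distrib)
  qed
qed

end

theory Submission imports Defs begin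

text \<open>
  Write \<open>P\<^sub>t\<close> for the semigroup, \<open>V\<close> for the variance of \<open>f\<close>, \<open>v t\<close> for the variance of \<open>P\<^sub>t f\<close>,
  \<open>J\<close> for \<open>J_fun\<close> and \<open>m = min 1 \<rho>\<^sub>L\<close>. The proof compares two facts about the decay of \<open>v\<close>.

  Decay is slow if \<open>A\<close> is small. By the \<open>0\<close>-CSGE, \<open>P\<^sub>t\<close> turns a function bounded by \<open>1\<close> into one
  whose gradient is at most a multiple of \<open>1 / sqrt t\<close> pointwise (\<open>reverse_poincare\<close>). Hence the
  Dirichlet form of \<open>f\<close> and \<open>P\<^sub>s f\<close> is at most a multiple of \<open>A / sqrt s\<close>, and integrating over
  \<open>s \<le> t\<close> gives \<open>V - v (t / 2) \<le> C * sqrt t * A\<close> for \<open>t \<le> 1\<close> (\<open>noise_stability_ge\<close>). So any time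
  \<open>t \<le> 1\<close> with \<open>v (t / 2) \<le> V / 2\<close> yields \<open>A \<ge> V / (2 * C * sqrt t)\<close>.

  Decay is fast if \<open>J\<close> is small. The log-Sobolev inequality gives
  \<open>\<parallel>P\<^sub>t h\<parallel>\<^sub>2\<^sup>2 \<le> \<parallel>h\<parallel>\<^sub>1\<^bsup>2\<theta>\<^esup> \<parallel>h\<parallel>\<^sub>2\<^bsup>2(1-\<theta>)\<^esup>\<close> with \<open>\<theta> = 1 - e\<^bsup>-\<rho>t\<^esup>\<close> for \<open>h \<ge> 0\<close> (\<open>semigroup_smoothing\<close>), a
  substitute for hypercontractivity with a shorter proof. Applied to the absolute partial
  derivatives of \<open>P\<^sub>\<tau> f\<close>, it combines with both CSGE hypotheses and Hoelder's inequality over the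
  coordinates to bound \<open>v (2 * \<tau>)\<close> by a multiple of \<open>J\<^bsup>\<theta>\<^esup> V\<^bsup>1-\<theta>\<^esup> / (\<rho>\<^sub>L \<tau>)\<close> (\<open>energy_le_J\<close>). For sets of
  small measure, where \<open>J\<close> need not be small compared with \<open>V\<close>, the same smoothing estimate applied
  to \<open>\<bar>f - E f\<bar>\<close> gives \<open>v t \<le> V\<^bsup>1+\<theta>\<^esup>\<close> instead (\<open>sign_function_energy_le\<close>).

  These bounds are used at the fixed time \<open>T = min 1 (1 / \<rho>\<^sub>L) / 2\<close>. They give
  \<open>v T \<le> V * e\<^bsup>-y\<^esup>\<close> with \<open>y\<close> of the order of \<open>m * ln (1 / J)\<close>, as long as this logarithm exceeds a
  multiple of \<open>(1 + log_plus (1 / \<rho>\<^sub>L)) / m\<close>. Using them directly at the time at which \<open>v\<close> has halved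
  would lose an iterated logarithm, because of the factor \<open>1 / (\<rho>\<^sub>L \<tau>)\<close>. Log-convexity of \<open>v\<close> avoids
  this: it gives \<open>v (T / y) \<le> V / e\<close> up to rounding \<open>y\<close> to a power of two (\<open>energy_dyadic\<close>), and the
  first fact at a time of the order of \<open>T / y\<close> is the claim. If \<open>ln (1 / J)\<close> is below the threshold,
  the Poincare inequality at time \<open>T\<close> suffices; this is where the factor
  \<open>m / sqrt (1 + log_plus (1 / \<rho>\<^sub>L))\<close> comes from.
\<close>

section \<open>Comparison lemmas for real functions\<close>

lemma gronwall_decay:
  fixes f f' :: "real \<Rightarrow> real"
  assumes d: "\<And>s. 0 \<le> s \<Longrightarrow> (f has_real_derivative f' s) (at s)"
    and le: "\<And>s. 0 \<le> s \<Longrightarrow> f' s \<le> - k * f s"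
    and t: "0 \<le> t"
  shows "f t \<le> exp (- k * t) * f 0"
proof -
  have "exp (k * t) * f t \<le> exp (k * 0) * f 0"
  proof (rule DERIV_nonpos_imp_nonincreasing[OF t])
    fix s :: real assume s: "0 \<le> s" "s \<le> t"
    have "((\<lambda>s. exp (k * s) * f s) has_real_derivative exp (k * s) * (f' s + k * f s)) (at s)"
      by (auto intro!: derivative_eq_intros d[OF s(1)] simp: algebra_simps)
    moreover have "exp (k * s) * (f' s + k * f s) \<le> 0"
      using le[OF s(1)] by (intro mult_nonneg_nonpos) auto
    ultimately show "\<exists>y. ((\<lambda>s. exp (k * s) * f s) has_real_derivative y) (at s) \<and> y \<le> 0"
      by blast
  qed
  then have "exp (- (k * t)) * (exp (k * t) * f t) \<le> exp (- (k * t)) * f 0"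
    by (intro mult_left_mono) auto
  moreover have "exp (- (k * t)) * (exp (k * t) * f t) = f t"
    by (simp add: mult.assoc[symmetric] exp_add[symmetric])
  ultimately show ?thesis by simp
qed

text \<open>
  The squared negative part is continuously differentiable, also at \<open>0\<close>. This makes it usable as an
  energy in a differential inequality.
\<close>

lemma has_real_derivative_min_0_sq:
  "((\<lambda>y::real. (min y 0)\<^sup>2) has_real_derivative 2 * min y 0) (at y)"
proof -
  consider "y < 0" | "y > 0" | "y = 0" by linarith
  then show ?thesis
  proof cases
    case 1
    have "((\<lambda>y::real. y\<^sup>2) has_real_derivative 2 * y) (at y)"
      by (auto intro!: derivative_eq_intros)
    then have "((\<lambda>y::real. (min y 0)\<^sup>2) has_real_derivative 2 * y) (at y)"
      by (rule has_field_derivative_transform_within_open[where S = "{..<0}"]) (use 1 in auto)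
    then show ?thesis using 1 by (simp add: min_def)
  next
    case 2
    have "((\<lambda>y::real. (min y 0)\<^sup>2) has_real_derivative 0) (at y)"
      by (rule has_field_derivative_transform_within_open[where S = "{0<..}" and f = "\<lambda>_. 0"])
         (use 2 in auto)
    then show ?thesis using 2 by (simp add: min_def)
  next
    case 3
    have "((\<lambda>h::real. (min h 0)\<^sup>2 / h) \<longlongrightarrow> 0) (at 0)"
    proof (rule Lim_null_comparison)
      show "\<forall>\<^sub>F h in at 0. norm ((min h 0)\<^sup>2 / h) \<le> \<bar>h::real\<bar>"
        by (rule eventually_mono[OF eventually_True])
           (auto simp: min_def power2_eq_square abs_if)
      show "((\<lambda>h::real. \<bar>h\<bar>) \<longlongrightarrow> 0) (at 0)"
        by (rule tendsto_rabs_zero) (rule tendsto_ident_at)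
    qed
    then show ?thesis using 3 by (simp add: DERIV_def)
  qed
qed

section \<open>The semigroup on the cube\<close>

lemma generator_linear:
  "generator n q (\<lambda>x. a * f x + c * g x) = (\<lambda>x. a * generator n q f x + c * generator n q g x)"
  by (rule ext)
     (simp add: generator_def sum_distrib_left sum.distrib[symmetric] algebra_simps)

lemma generator_pow_linear:
  "(generator n q ^^ k) (\<lambda>x. a * f x + c * g x)
     = (\<lambda>x. a * (generator n q ^^ k) f x + c * (generator n q ^^ k) g x)"
  by (induction k) (simp_all add: generator_linear)

lemma generator_cong:
  assumes "\<And>y. y \<in> cube n \<Longrightarrow> f y = g y" "x \<in> cube n"
  shows "generator n q f x = generator n q g x"
  unfolding generator_def by (intro sum.cong refl) (simp add: assms flip_in_cube)

lemma generator_pow_cong: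
  assumes "\<And>y. y \<in> cube n \<Longrightarrow> f y = g y" "x \<in> cube n"
  shows "(generator n q ^^ k) f x = (generator n q ^^ k) g x"
  using assms(2)
proof (induction k arbitrary: x)
  case 0
  then show ?case by (simp add: assms(1))
next
  case (Suc k)
  then show ?case by (auto intro: generator_cong)
qed

lemma semigroup_cong:
  assumes "\<And>y. y \<in> cube n \<Longrightarrow> f y = g y" "x \<in> cube n"
  shows "semigroup n q t f x = semigroup n q t g x"
  unfolding semigroup_def using generator_pow_cong[OF assms] by simp

lemma semigroup_linear:
  assumes "x \<in> cube n"
  shows "semigroup n q t (\<lambda>x. a * f x + c * g x) x
           = a * semigroup n q t f x + c * semigroup n q t g x"
proof -
  note S = summable_semigroup[OF assms]
  have "semigroup n q t (\<lambda>x. a * f x + c * g x) x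
      = (\<Sum>k. a * (t ^ k / fact k * (generator n q ^^ k) f x)
             + c * (t ^ k / fact k * (generator n q ^^ k) g x))"
    unfolding semigroup_def generator_pow_linear by (simp add: algebra_simps)
  also have "\<dots> = a * semigroup n q t f x + c * semigroup n q t g x"
    unfolding semigroup_def
    by (subst suminf_add[symmetric], (intro summable_mult S)+)
       (simp only: suminf_mult[OF S])
  finally show ?thesis .
qed

lemma semigroup_sum:
  assumes "finite Y" "x \<in> cube n"
  shows "semigroup n q t (\<lambda>x. \<Sum>y\<in>Y. c y * g y x) x = (\<Sum>y\<in>Y. c y * semigroup n q t (g y) x)"
  using assms(1)
proof (induction Y rule: finite_induct)
  case empty
  show ?case using semigroup_linear[OF assms(2), of q t 0 "\<lambda>_. 0" 0 "\<lambda>_. 0"] by simp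
next
  case (insert y Y)
  then show ?case
    using semigroup_linear[OF assms(2), of q t "c y" "g y" 1 "\<lambda>x. \<Sum>y\<in>Y. c y * g y x"]
    by simp
qed

text \<open>
  On the cube \<open>P\<^sub>t\<close> is a matrix. Writing it as a finite sum of products separates the dependence on
  time from the dependence on the function, so that both may vary at once in
  \<open>semigroup_chain_rule\<close>.
\<close>

lemma semigroup_kernel:
  assumes "x \<in> cube n"
  shows "semigroup n q t f x = (\<Sum>y\<in>cube n. f y * semigroup n q t (indicator {y}) x)"
proof -
  have "semigroup n q t f x = semigroup n q t (\<lambda>x. \<Sum>y\<in>cube n. f y * indicator {y} x) x"
    by (rule semigroup_cong[OF _ assms])
       (simp add: indicator_def if_distrib sum.delta finite_cube eq_commute cong: if_cong)
  then show ?thesis by (simp add: semigroup_sum[OF finite_cube assms])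
qed

lemma semigroup_0: "semigroup n q 0 f x = f x"
proof -
  have "(\<lambda>k. 0 ^ k / fact k * (generator n q ^^ k) f x) sums (\<Sum>k\<in>{0}. 0 ^ k / fact k * (generator n q ^^ k) f x)"
    by (rule sums_finite) auto
  then show ?thesis unfolding semigroup_def by (simp add: sums_iff)
qed

lemma semigroup_has_derivative:
  assumes "x \<in> cube n"
  shows "((\<lambda>t. semigroup n q t f x) has_real_derivative semigroup n q t (generator n q f) x) (at t)"
proof -
  define c where "c k = (generator n q ^^ k) f x / fact k" for k
  have eq: "semigroup n q s f x = (\<Sum>k. c k * s ^ k)" for s
    unfolding semigroup_def c_def by (simp add: mult_ac)
  have d: "diffs c k = (generator n q ^^ k) (generator n q f) x / fact k" for k
    unfolding diffs_def c_def by (simp add: funpow_swap1 field_simps del: of_nat_Suc)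
  have "summable (\<lambda>k. c k * s ^ k)" for s
    using summable_semigroup[OF assms, of s q f] by (simp add: c_def mult_ac)
  then have "((\<lambda>s. \<Sum>k. c k * s ^ k) has_real_derivative (\<Sum>k. diffs c k * t ^ k)) (at t)"
    by (intro termdiffs_strong_converges_everywhere) auto
  moreover have "(\<Sum>k. diffs c k * t ^ k) = semigroup n q t (generator n q f) x"
    unfolding semigroup_def d by (simp add: mult_ac)
  ultimately show ?thesis unfolding eq by simp
qed

lemma semigroup_generator_commute:
  assumes "x \<in> cube n"
  shows "semigroup n q t (generator n q f) x = generator n q (semigroup n q t f) x"
proof -
  have "semigroup n q t (generator n q f) x
      = (\<Sum>k. \<Sum>i=1..n. q i x * (t ^ k / fact k * (generator n q ^^ k) f (flip i x)
                           - t ^ k / fact k * (generator n q ^^ k) f x))"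
    unfolding semigroup_def funpow_swap1[symmetric]
    by (simp add: generator_def sum_distrib_left algebra_simps)
  also have "\<dots> = (\<Sum>i=1..n. \<Sum>k. q i x * (t ^ k / fact k * (generator n q ^^ k) f (flip i x)
                           - t ^ k / fact k * (generator n q ^^ k) f x))"
    by (rule suminf_sum) (intro summable_mult summable_diff summable_semigroup flip_in_cube assms)
  also have "\<dots> = generator n q (semigroup n q t f) x"
    unfolding generator_def[of n q "semigroup n q t f"]
  proof (rule sum.cong[OF refl])
    fix i assume "i \<in> {1..n}"
    then have fx: "flip i x \<in> cube n" using assms by (intro flip_in_cube)
    show "(\<Sum>k. q i x * (t ^ k / fact k * (generator n q ^^ k) f (flip i x)
                           - t ^ k / fact k * (generator n q ^^ k) f x))
        = q i x * (semigroup n q t f (flip i x) - semigroup n q t f x)"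
      unfolding semigroup_def
      by (simp only: suminf_mult[OF summable_diff[OF summable_semigroup[OF fx] summable_semigroup[OF assms]]]
            suminf_diff[OF summable_semigroup[OF fx] summable_semigroup[OF assms]])
  qed
  finally show ?thesis .
qed

lemma semigroup_chain_rule:
  assumes x: "x \<in> cube n"
    and h: "\<And>y. y \<in> cube n \<Longrightarrow> ((\<lambda>s. h s y) has_real_derivative h' y) (at s)"
    and a: "(a has_real_derivative a') (at s)"
  shows "((\<lambda>s. semigroup n q (a s) (h s) x) has_real_derivative
            a' * semigroup n q (a s) (generator n q (h s)) x + semigroup n q (a s) h' x) (at s)"
proof -
  let ?p = "\<lambda>t y. semigroup n q t (indicator {y}) x"
  let ?p' = "\<lambda>t y. semigroup n q t (generator n q (indicator {y})) x"
  have p: "((\<lambda>s. ?p (a s) y) has_real_derivative ?p' (a s) y * a') (at s)" for y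
    using DERIV_chain2[OF semigroup_has_derivative[OF x] a] .
  have "((\<lambda>s. \<Sum>y\<in>cube n. h s y * ?p (a s) y) has_real_derivative
           (\<Sum>y\<in>cube n. h' y * ?p (a s) y + ?p' (a s) y * a' * h s y)) (at s)"
    by (intro DERIV_sum DERIV_mult h p)
  moreover have "(\<Sum>y\<in>cube n. h s y * ?p' (a s) y) = semigroup n q (a s) (generator n q (h s)) x"
  proof (rule DERIV_unique)
    show "((\<lambda>t. semigroup n q t (h s) x) has_real_derivative
        semigroup n q (a s) (generator n q (h s)) x) (at (a s))"
      by (rule semigroup_has_derivative[OF x])
    show "((\<lambda>t. semigroup n q t (h s) x) has_real_derivative
        (\<Sum>y\<in>cube n. h s y * ?p' (a s) y)) (at (a s))"
      unfolding semigroup_kernel[OF x, of q _ "h s"]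
      by (intro DERIV_sum DERIV_cmult semigroup_has_derivative[OF x])
  qed
  moreover have "(\<Sum>y\<in>cube n. h' y * ?p (a s) y + ?p' (a s) y * a' * h s y)
      = a' * (\<Sum>y\<in>cube n. h s y * ?p' (a s) y) + (\<Sum>y\<in>cube n. h' y * ?p (a s) y)"
    by (simp add: sum.distrib sum_distrib_left mult_ac add_ac)
  ultimately show ?thesis
    by (simp only: semigroup_kernel[OF x, of q _ "h _"] semigroup_kernel[OF x, of q _ h'])
qed

text \<open>
  The derivative of \<open>P\<^bsub>s+t-r\<^esub> P\<^sub>r f\<close> in \<open>r\<close> vanishes, because \<open>P\<close> commutes with the generator; the
  values at \<open>r = 0\<close> and \<open>r = t\<close> are the two sides.
\<close>

lemma semigroup_add:
  assumes x: "x \<in> cube n"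
  shows "semigroup n q (s + t) f x = semigroup n q s (semigroup n q t f) x"
proof -
  have "((\<lambda>r. semigroup n q (s + t - r) (semigroup n q r f) x) has_real_derivative 0) (at r)" for r
  proof -
    have "((\<lambda>r. semigroup n q (s + t - r) (semigroup n q r f) x) has_real_derivative
        (-1) * semigroup n q (s + t - r) (generator n q (semigroup n q r f)) x
        + semigroup n q (s + t - r) (semigroup n q r (generator n q f)) x) (at r)"
      by (rule semigroup_chain_rule[OF x semigroup_has_derivative])
         (auto intro!: derivative_eq_intros)
    moreover have "semigroup n q (s + t - r) (semigroup n q r (generator n q f)) x
        = semigroup n q (s + t - r) (generator n q (semigroup n q r f)) x"
      by (rule semigroup_cong[OF semigroup_generator_commute x])
    ultimately show ?thesis by simp
  qed
  then have "semigroup n q (s + t - 0) (semigroup n q 0 f) x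
      = semigroup n q (s + t - t) (semigroup n q t f) x"
    by (intro DERIV_isconst_all[where f = "\<lambda>r. semigroup n q (s + t - r) (semigroup n q r f) x"]) auto
  moreover have "semigroup n q 0 f = f" by (rule ext) (rule semigroup_0)
  ultimately show ?thesis by simp
qed

lemma semigroup_const:
  assumes x: "x \<in> cube n"
  shows "semigroup n q t (\<lambda>_. c) x = c"
proof -
  have "generator n q (\<lambda>_. c) = (\<lambda>_. 0)" by (rule ext) (simp add: generator_def)
  moreover have "semigroup n q r (\<lambda>_. 0) x = 0" for r
    using semigroup_linear[OF x, of q r 0 "\<lambda>_. 0" 0 "\<lambda>_. 0"] by simp
  ultimately have "((\<lambda>r. semigroup n q r (\<lambda>_. c) x) has_real_derivative 0) (at r)" for r
    using semigroup_has_derivative[OF x, of q "\<lambda>_. c" r] by simp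
  then have "semigroup n q t (\<lambda>_. c) x = semigroup n q 0 (\<lambda>_. c) x"
    by (intro DERIV_isconst_all[where f = "\<lambda>r. semigroup n q r (\<lambda>_. c) x"]) auto
  then show ?thesis by (simp add: semigroup_0)
qed

section \<open>Positivity\<close>

text \<open>
  The local form of the estimate for \<open>semigroup_nonneg\<close>: with \<open>a = f x\<close> and \<open>c = f (flip i x)\<close> it bounds
  the product of the negative part with one term of the generator.
\<close>

lemma min_0_mult_le:
  fixes a c :: real
  shows "min a 0 * (c - a) \<le> (min c 0)\<^sup>2 / 2 - (min a 0)\<^sup>2 / 2"
proof -
  have "min a 0 * c \<le> min a 0 * min c 0" by (intro mult_left_mono_neg) auto
  moreover have "min a 0 * a = (min a 0)\<^sup>2" by (auto simp: min_def power2_eq_square)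
  moreover have "2 * (min a 0 * min c 0) \<le> (min a 0)\<^sup>2 + (min c 0)\<^sup>2"
    using sum_squares_bound[of "min a 0" "min c 0"] by simp
  ultimately show ?thesis by (simp add: right_diff_distrib)
qed

text \<open>
  Let \<open>N s\<close> be the sum over the cube of the squared negative parts of \<open>P\<^sub>s f\<close>. By \<open>min_0_mult_le\<close> and
  nonnegativity of the rates, \<open>N' \<le> k N\<close> for a constant \<open>k\<close>; since \<open>N 0 = 0\<close>, Gronwall's
  lemma gives \<open>N = 0\<close>.
\<close>

lemma semigroup_nonneg:
  assumes rates: "transition_rates n q"
    and f: "\<And>y. y \<in> cube n \<Longrightarrow> 0 \<le> f y"
    and t: "0 \<le> t" and x: "x \<in> cube n"
  shows "0 \<le> semigroup n q t f x"
proof -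
  define u where "u = (\<lambda>s y. min (semigroup n q s f y) 0)"
  define N where "N s = (\<Sum>y\<in>cube n. (u s y)\<^sup>2)" for s
  define N' where "N' s = (\<Sum>y\<in>cube n. 2 * u s y * generator n q (semigroup n q s f) y)" for s
  define Q where "Q = (\<Sum>y\<in>cube n. \<Sum>i=1..n. q i y)"
  have q0: "0 \<le> q i y" if "i \<in> {1..n}" "y \<in> cube n" for i y
    using rates that by (simp add: transition_rates_def)
  have qQ: "(\<Sum>i=1..n. q i y) \<le> Q" if "y \<in> cube n" for y
    unfolding Q_def using that by (intro member_le_sum finite_cube) (auto intro!: sum_nonneg q0)
  have N0: "0 \<le> N s" for s unfolding N_def by (intro sum_nonneg) auto
  have uN: "(u s y)\<^sup>2 \<le> N s" if "y \<in> cube n" for s y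
    unfolding N_def using that by (intro member_le_sum finite_cube) auto
  have d: "(N has_real_derivative N' s) (at s)" for s
    unfolding N_def N'_def u_def
  proof (rule DERIV_sum)
    fix y assume "y \<in> cube n"
    from DERIV_chain2[OF has_real_derivative_min_0_sq semigroup_has_derivative[OF this]]
    show "((\<lambda>s. (min (semigroup n q s f y) 0)\<^sup>2) has_real_derivative
        2 * min (semigroup n q s f y) 0 * generator n q (semigroup n q s f) y) (at s)"
      by (simp add: semigroup_generator_commute[OF \<open>y \<in> cube n\<close>])
  qed
  have le: "N' s \<le> - (- (real (card (cube n)) * Q)) * N s" for s
  proof -
    have "2 * u s y * generator n q (semigroup n q s f) y \<le> Q * N s" if y: "y \<in> cube n" for y
    proof -
      have "2 * u s y * generator n q (semigroup n q s f) y
          = (\<Sum>i=1..n. q i y * (2 * (u s y * (semigroup n q s f (flip i y) - semigroup n q s f y))))"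
        unfolding generator_def by (simp add: sum_distrib_left mult_ac)
      also have "\<dots> \<le> (\<Sum>i=1..n. q i y * N s)"
      proof (intro sum_mono mult_left_mono q0 y)
        fix i assume i: "i \<in> {1..n}"
        have "2 * (u s y * (semigroup n q s f (flip i y) - semigroup n q s f y))
            \<le> (u s (flip i y))\<^sup>2 - (u s y)\<^sup>2"
          using min_0_mult_le[of "semigroup n q s f y" "semigroup n q s f (flip i y)"]
          unfolding u_def by linarith
        also have "\<dots> \<le> N s" using uN[OF flip_in_cube[OF y i], of s] zero_le_power2[of "u s y"] by linarith
        finally show "2 * (u s y * (semigroup n q s f (flip i y) - semigroup n q s f y)) \<le> N s" .
      qed
      also have "\<dots> \<le> Q * N s"
        unfolding sum_distrib_right[symmetric] using qQ[OF y] N0 by (intro mult_right_mono)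
      finally show ?thesis .
    qed
    then have "N' s \<le> (\<Sum>y\<in>cube n. Q * N s)" unfolding N'_def by (intro sum_mono)
    then show ?thesis by (simp add: mult_ac)
  qed
  have "N t \<le> exp (- (- (real (card (cube n)) * Q)) * t) * N 0"
    by (rule gronwall_decay[OF d le t])
  moreover have "N 0 = 0" unfolding N_def u_def by (simp add: semigroup_0 f)
  ultimately have "N t \<le> 0" by simp
  with uN[OF x, of t] have "(u t x)\<^sup>2 \<le> 0" by (rule order_trans)
  then show ?thesis unfolding u_def by (simp add: min_def split: if_splits)
qed

locale cube_rates =
  fixes n :: nat and q :: vfield
  assumes rates: "transition_rates n q"
begin

abbreviation "P \<equiv> semigroup n q"
abbreviation "L \<equiv> generator n q"

lemma rate_nonneg: "i \<in> {1..n} \<Longrightarrow> x \<in> cube n \<Longrightarrow> 0 \<le> q i x"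
  using rates by (simp add: transition_rates_def)

lemma semigroup_deriv:
  assumes "x \<in> cube n"
  shows "((\<lambda>s. P s f x) has_real_derivative L (P t f) x) (at t)"
  using semigroup_has_derivative[OF assms] by (simp add: semigroup_generator_commute[OF assms])

lemma semigroup_deriv_reflect:
  assumes "x \<in> cube n"
  shows "((\<lambda>s. P (c - s) f x) has_real_derivative - L (P (c - t) f) x) (at t)"
proof -
  have "((\<lambda>s. c - s) has_real_derivative -1) (at t)" by (auto intro!: derivative_eq_intros)
  from DERIV_chain2[OF semigroup_deriv[OF assms] this] show ?thesis by simp
qed

lemma semigroup_mono:
  assumes "\<And>y. y \<in> cube n \<Longrightarrow> f y \<le> g y" "0 \<le> t" "x \<in> cube n"
  shows "P t f x \<le> P t g x"
  using semigroup_nonneg[OF rates, of "\<lambda>x. 1 * g x + (-1) * f x" t x] assms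
    semigroup_linear[OF assms(3), of q t 1 g "-1" f] by simp

text \<open>
  Jensen's inequality, by expanding the nonnegative function \<open>P\<^sub>t ((h - c)\<^sup>2)\<close> at \<open>x\<close> for
  \<open>c = P\<^sub>t h x\<close>.
\<close>

lemma semigroup_square_le:
  assumes t: "0 \<le> t" and x: "x \<in> cube n"
  shows "(P t h x)\<^sup>2 \<le> P t (\<lambda>y. (h y)\<^sup>2) x"
proof -
  define c where "c = P t h x"
  have "P t (\<lambda>y. 1 * ((h y)\<^sup>2) + 1 * ((-2 * c) * h y + 1 * c\<^sup>2)) x
      = P t (\<lambda>y. (h y)\<^sup>2) x + ((-2 * c) * c + c\<^sup>2)"
    by (simp only: semigroup_linear[OF x] semigroup_const[OF x] c_def[symmetric]) simp
  moreover have "0 \<le> P t (\<lambda>y. 1 * ((h y)\<^sup>2) + 1 * ((-2 * c) * h y + 1 * c\<^sup>2)) x"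
  proof (rule semigroup_nonneg[OF rates _ t x])
    fix y
    have "0 \<le> (h y - c)\<^sup>2" by simp
    then show "0 \<le> 1 * ((h y)\<^sup>2) + 1 * ((-2 * c) * h y + 1 * c\<^sup>2)"
      by (simp add: power2_diff algebra_simps)
  qed
  ultimately have "0 \<le> P t (\<lambda>y. (h y)\<^sup>2) x + ((-2 * c) * c + c\<^sup>2)" by simp
  then show ?thesis unfolding c_def[symmetric] by (simp add: power2_eq_square)
qed

lemma generator_square:
  "L (\<lambda>y. (g y)\<^sup>2) x = 2 * g x * L g x + 2 * Gamma_op n q g x"
  unfolding generator_def Gamma_op_def
  by (simp add: sum_distrib_left sum.distrib[symmetric] power2_eq_square algebra_simps)

lemma semigroup_bounded:
  assumes "\<And>y. y \<in> cube n \<Longrightarrow> (f y)\<^sup>2 \<le> 1" "0 \<le> t" "x \<in> cube n"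
  shows "P t (\<lambda>y. (f y)\<^sup>2) x \<le> 1"
  using semigroup_mono[of "\<lambda>y. (f y)\<^sup>2" "\<lambda>_. 1" t x] assms by (simp add: semigroup_const)

end

section \<open>Reversibility\<close>

locale reversible_cube = cube_rates +
  fixes \<mu> :: "point pmf"
  assumes distr: "distribution_on_cube n \<mu>"
    and rev: "reversible n \<mu> q"
begin

definition E :: "(point \<Rightarrow> real) \<Rightarrow> real" where
  "E f = (\<Sum>x\<in>cube n. pmf \<mu> x * f x)"

definition Dirichlet :: "(point \<Rightarrow> real) \<Rightarrow> (point \<Rightarrow> real) \<Rightarrow> real" where
  "Dirichlet f g = E (\<lambda>x. \<Sum>i=1..n. 1 / 2 * q i x * (f (flip i x) - f x) * (g (flip i x) - g x))"

lemma expectation_eq_E: "measure_pmf.expectation \<mu> f = E f"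
  unfolding E_def using distr finite_cube
  by (subst integral_measure_pmf_real[of "cube n"])
     (auto simp: distribution_on_cube_def mult.commute)

lemma E_cong: "(\<And>x. x \<in> cube n \<Longrightarrow> f x = g x) \<Longrightarrow> E f = E g"
  unfolding E_def by simp

lemma E_mono: "(\<And>x. x \<in> cube n \<Longrightarrow> f x \<le> g x) \<Longrightarrow> E f \<le> E g"
  unfolding E_def by (intro sum_mono mult_left_mono) auto

lemma E_add: "E (\<lambda>x. f x + g x) = E f + E g"
  unfolding E_def by (simp add: distrib_left sum.distrib)

lemma E_diff: "E (\<lambda>x. f x - g x) = E f - E g"
  unfolding E_def by (simp add: right_diff_distrib sum_subtractf)

lemma E_cmult: "E (\<lambda>x. c * f x) = c * E f"
  unfolding E_def by (simp add: sum_distrib_left mult_ac)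

lemma E_sum: "E (\<lambda>x. \<Sum>i\<in>I. f i x) = (\<Sum>i\<in>I. E (f i))"
  unfolding E_def sum_distrib_left by (rule sum.swap)

lemma E_const: "E (\<lambda>_. c) = c"
  using expectation_eq_E[of "\<lambda>_. c"] by simp

lemma E_nonneg: "(\<And>x. x \<in> cube n \<Longrightarrow> 0 \<le> f x) \<Longrightarrow> 0 \<le> E f"
  unfolding E_def by (intro sum_nonneg mult_nonneg_nonneg) auto

lemma E_has_derivative:
  assumes "\<And>x. x \<in> cube n \<Longrightarrow> ((\<lambda>s. h s x) has_real_derivative h' x) (at s)"
  shows "((\<lambda>s. E (h s)) has_real_derivative E h') (at s)"
  unfolding E_def by (intro DERIV_sum DERIV_cmult assms)

lemma flip_flip [simp]: "flip i (flip i x) = x"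
  by (simp add: flip_def)

lemma sum_cube_flip:
  assumes "i \<in> {1..n}"
  shows "(\<Sum>x\<in>cube n. F (flip i x)) = (\<Sum>x\<in>cube n. F x)"
  by (rule sum.reindex_bij_witness[of _ "flip i" "flip i"])
     (use assms in \<open>auto intro: flip_in_cube\<close>)

lemma E_flip:
  assumes i: "i \<in> {1..n}"
  shows "E (\<lambda>x. q i x * F (flip i x)) = E (\<lambda>x. q i x * F x)"
proof -
  have "E (\<lambda>x. q i x * F (flip i x))
      = (\<Sum>x\<in>cube n. pmf \<mu> (flip i x) * q i (flip i x) * F (flip i x))"
    unfolding E_def mult.assoc[symmetric]
    using rev i by (intro sum.cong) (auto simp: reversible_def)
  also have "\<dots> = (\<Sum>x\<in>cube n. pmf \<mu> x * q i x * F x)"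
    by (rule sum_cube_flip[OF i])
  finally show ?thesis by (simp add: E_def mult.assoc)
qed

lemma Dirichlet_commute: "Dirichlet f g = Dirichlet g f"
  unfolding Dirichlet_def by (simp add: mult_ac)

text \<open>
  Summation by parts: reversibility allows replacing \<open>x\<close> by \<open>flip i x\<close> in the \<open>i\<close>-th term, and the
  average of the two forms is minus the Dirichlet form.
\<close>

lemma E_mult_generator: "E (\<lambda>x. f x * L g x) = - Dirichlet f g"
proof -
  have "E (\<lambda>x. q i x * (f x * (g (flip i x) - g x)))
      = - E (\<lambda>x. 1 / 2 * q i x * (f (flip i x) - f x) * (g (flip i x) - g x))"
    if i: "i \<in> {1..n}" for i
  proof -
    have "E (\<lambda>x. q i x * (f (flip i x) * (g x - g (flip i x))))
        = E (\<lambda>x. q i x * (f x * (g (flip i x) - g x)))"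
      using E_flip[OF i, of "\<lambda>x. f x * (g (flip i x) - g x)"] by simp
    moreover have "E (\<lambda>x. q i x * (f (flip i x) * (g x - g (flip i x))))
        + E (\<lambda>x. q i x * (f x * (g (flip i x) - g x)))
        = -2 * E (\<lambda>x. 1 / 2 * q i x * (f (flip i x) - f x) * (g (flip i x) - g x))"
      unfolding E_add[symmetric] E_cmult[symmetric]
      by (rule E_cong) (simp add: algebra_simps)
    ultimately show ?thesis by linarith
  qed
  moreover have "E (\<lambda>x. f x * L g x) = (\<Sum>i=1..n. E (\<lambda>x. q i x * (f x * (g (flip i x) - g x))))"
    unfolding E_sum[symmetric] generator_def by (rule E_cong) (simp add: sum_distrib_left mult_ac)
  ultimately show ?thesis
    unfolding Dirichlet_def E_sum by (simp add: sum_negf)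
qed

lemma generator_symmetric: "E (\<lambda>x. f x * L g x) = E (\<lambda>x. L f x * g x)"
  using E_mult_generator[of f g] E_mult_generator[of g f] Dirichlet_commute[of f g]
  by (simp add: mult.commute)

lemma Dirichlet_Gamma: "Dirichlet g g = E (Gamma_op n q g)"
  unfolding Dirichlet_def Gamma_op_def by (simp add: sum_distrib_left power2_eq_square mult_ac)

lemma Dirichlet_nonneg: "0 \<le> Dirichlet g g"
  unfolding Dirichlet_Gamma Gamma_op_def
  by (auto intro!: E_nonneg sum_nonneg mult_nonneg_nonneg rate_nonneg)

text \<open>
  The expectation of \<open>P\<^sub>s f * P\<^bsub>t-s\<^esub> g\<close> does not depend on \<open>s\<close>, since the generator is symmetric.
\<close>

lemma semigroup_symmetric: "E (\<lambda>x. f x * P t g x) = E (\<lambda>x. P t f x * g x)"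
proof -
  have "((\<lambda>s. E (\<lambda>x. P s f x * P (t - s) g x)) has_real_derivative 0) (at s)" for s
  proof -
    have "((\<lambda>s. E (\<lambda>x. P s f x * P (t - s) g x)) has_real_derivative
        E (\<lambda>x. L (P s f) x * P (t - s) g x + - L (P (t - s) g) x * P s f x)) (at s)"
      by (intro E_has_derivative DERIV_mult semigroup_deriv semigroup_deriv_reflect)
    moreover have "E (\<lambda>x. L (P s f) x * P (t - s) g x + - L (P (t - s) g) x * P s f x)
        = E (\<lambda>x. L (P s f) x * P (t - s) g x) - E (\<lambda>x. P s f x * L (P (t - s) g) x)"
      unfolding E_diff[symmetric] by (simp add: mult_ac)
    ultimately show ?thesis using generator_symmetric by simp
  qed
  then have "E (\<lambda>x. P 0 f x * P (t - 0) g x) = E (\<lambda>x. P t f x * P (t - t) g x)"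
    by (intro DERIV_isconst_all[where f = "\<lambda>s. E (\<lambda>x. P s f x * P (t - s) g x)"]) auto
  then show ?thesis by (simp add: semigroup_0)
qed

lemma E_semigroup: "E (P t f) = E f"
proof -
  have "E (P t f) = E (\<lambda>x. P t (\<lambda>_. 1) x * f x)"
    using semigroup_symmetric[of "\<lambda>_. 1" t f] by simp
  also have "\<dots> = E f" by (rule E_cong) (simp add: semigroup_const)
  finally show ?thesis .
qed

lemma E_mult_semigroup_double: "E (\<lambda>x. f x * P (t + t) f x) = E (\<lambda>x. (P t f x)\<^sup>2)"
proof -
  have "E (\<lambda>x. f x * P (t + t) f x) = E (\<lambda>x. f x * P t (P t f) x)"
    by (rule E_cong) (simp only: semigroup_add)
  then show ?thesis by (simp add: semigroup_symmetric power2_eq_square)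
qed

lemma centered_energy:
  "E (\<lambda>x. (P t (\<lambda>x. f x - E f) x)\<^sup>2) = E (\<lambda>x. (P t f x)\<^sup>2) - (E f)\<^sup>2"
proof -
  have "E (\<lambda>x. (P t (\<lambda>x. f x - E f) x)\<^sup>2)
      = E (\<lambda>x. ((P t f x)\<^sup>2 - (2 * E f) * P t f x) + (E f)\<^sup>2)"
  proof (rule E_cong)
    fix x assume x: "x \<in> cube n"
    have "P t (\<lambda>x. 1 * f x + (- 1) * E f) x = 1 * P t f x + (- 1) * E f"
      by (simp only: semigroup_linear[OF x] semigroup_const[OF x])
    then show "(P t (\<lambda>x. f x - E f) x)\<^sup>2 = ((P t f x)\<^sup>2 - (2 * E f) * P t f x) + (E f)\<^sup>2"
      by (simp add: power2_diff)
  qed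
  also have "\<dots> = E (\<lambda>x. (P t f x)\<^sup>2) - (E f)\<^sup>2"
    unfolding E_add E_diff E_cmult E_const by (simp add: E_semigroup power2_eq_square)
  finally show ?thesis .
qed

lemma E_Cauchy_Schwarz: "(E (\<lambda>x. f x * g x))\<^sup>2 \<le> E (\<lambda>x. (f x)\<^sup>2) * E (\<lambda>x. (g x)\<^sup>2)"
proof -
  have "(\<Sum>x\<in>cube n. (sqrt (pmf \<mu> x) * f x) * (sqrt (pmf \<mu> x) * g x))\<^sup>2
      \<le> (\<Sum>x\<in>cube n. (sqrt (pmf \<mu> x) * f x)\<^sup>2) * (\<Sum>x\<in>cube n. (sqrt (pmf \<mu> x) * g x)\<^sup>2)"
    by (rule Cauchy_Schwarz_ineq_sum)
  moreover have "sqrt (pmf \<mu> x) * f x * (sqrt (pmf \<mu> x) * g x) = pmf \<mu> x * (f x * g x)" for x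
    using real_sqrt_mult_self[of "pmf \<mu> x"] by (simp add: algebra_simps)
  moreover have "(sqrt (pmf \<mu> x) * f x)\<^sup>2 = pmf \<mu> x * (f x)\<^sup>2" for x f
    by (simp add: power_mult_distrib)
  ultimately show ?thesis unfolding E_def by simp
qed

lemma energy_has_derivative:
  "((\<lambda>s. E (\<lambda>x. (P s g x)\<^sup>2)) has_real_derivative - 2 * Dirichlet (P t g) (P t g)) (at t)"
proof -
  have "((\<lambda>s. E (\<lambda>x. (P s g x)\<^sup>2)) has_real_derivative E (\<lambda>x. 2 * (P t g x * L (P t g) x))) (at t)"
    by (rule E_has_derivative) (auto intro!: derivative_eq_intros semigroup_deriv)
  then show ?thesis by (simp add: E_cmult E_mult_generator)
qed

end

section \<open>Consequences of the log-Sobolev inequality\<close>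

context reversible_cube
begin

lemma E_square_le: "(E h)\<^sup>2 \<le> E (\<lambda>x. (h x)\<^sup>2)"
  using E_Cauchy_Schwarz[of h "\<lambda>_. 1"] by (simp add: E_const)

lemma Ent_eq: "Ent \<mu> g = E (\<lambda>x. g x * ln (g x)) - E g * ln (E g)"
  unfolding Ent_def expectation_eq_E ..

lemma log_sobolev_Dirichlet:
  assumes "log_sobolev n \<mu> q \<rho>" "0 < \<rho>"
  shows "\<rho> * Ent \<mu> (\<lambda>x. (f x)\<^sup>2) \<le> 2 * Dirichlet f f"
  using assms unfolding log_sobolev_def Dirichlet_Gamma expectation_eq_E
  by (simp add: field_simps)

text \<open>
  Jensen's inequality for the logarithm under the probability density \<open>h\<^sup>2 / \<phi>\<close>, where \<open>\<phi>\<close> is the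
  second moment of \<open>h\<close>: the mean of \<open>1 / h\<close> under it is \<open>E h / \<phi>\<close>. The proof uses the pointwise tangent
  bound \<open>ln z \<le> z - 1\<close> at \<open>z = \<phi> / (h * E h)\<close>, so zeros of \<open>h\<close> cause no trouble.
\<close>

lemma Ent_square_ge:
  assumes h: "\<And>x. x \<in> cube n \<Longrightarrow> 0 \<le> h x" and pos: "0 < E h"
  shows "E (\<lambda>x. (h x)\<^sup>2) * ln (E (\<lambda>x. (h x)\<^sup>2) / (E h)\<^sup>2) \<le> Ent \<mu> (\<lambda>x. (h x)\<^sup>2)"
proof -
  define m where "m = E h"
  define \<phi> where "\<phi> = E (\<lambda>x. (h x)\<^sup>2)"
  have m: "0 < m" using pos by (simp add: m_def)
  have "0 < m\<^sup>2" using m by simp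
  also have "m\<^sup>2 \<le> \<phi>" unfolding m_def \<phi>_def by (rule E_square_le)
  finally have \<phi>: "0 < \<phi>" .
  have "2 * ln (\<phi> / m) * \<phi> = E (\<lambda>x. (2 * ln (\<phi> / m) + 2) * (h x)\<^sup>2 - 2 * \<phi> / m * h x)"
    unfolding E_diff E_cmult using m by (simp add: \<phi>_def[symmetric] m_def[symmetric] field_simps)
  also have "\<dots> \<le> E (\<lambda>x. (h x)\<^sup>2 * ln ((h x)\<^sup>2))"
  proof (rule E_mono)
    fix x assume x: "x \<in> cube n"
    show "(2 * ln (\<phi> / m) + 2) * (h x)\<^sup>2 - 2 * \<phi> / m * h x \<le> (h x)\<^sup>2 * ln ((h x)\<^sup>2)"
    proof (cases "h x = 0")
      case False
      then have hx: "0 < h x" using h[OF x] by simp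
      have "ln (\<phi> / (m * h x)) \<le> \<phi> / (m * h x) - 1"
        using \<phi> m hx by (intro ln_le_minus_one) auto
      moreover have "ln (\<phi> / (m * h x)) = ln (\<phi> / m) - ln (h x)"
        using \<phi> m hx by (simp add: ln_div ln_mult)
      ultimately have "ln (\<phi> / m) + 1 - \<phi> / (m * h x) \<le> ln (h x)" by linarith
      then have "2 * (h x)\<^sup>2 * (ln (\<phi> / m) + 1 - \<phi> / (m * h x)) \<le> 2 * (h x)\<^sup>2 * ln (h x)"
        by (intro mult_left_mono) auto
      moreover have "2 * (h x)\<^sup>2 * (ln (\<phi> / m) + 1 - \<phi> / (m * h x))
          = (2 * ln (\<phi> / m) + 2) * (h x)\<^sup>2 - 2 * \<phi> / m * h x"
        using m hx by (simp add: field_simps power2_eq_square)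
      ultimately show ?thesis using hx by (simp add: ln_realpow)
    qed simp
  qed
  finally have "2 * ln (\<phi> / m) * \<phi> - \<phi> * ln \<phi> \<le> Ent \<mu> (\<lambda>x. (h x)\<^sup>2)"
    unfolding Ent_eq \<phi>_def by simp
  moreover have "2 * ln (\<phi> / m) * \<phi> - \<phi> * ln \<phi> = \<phi> * ln (\<phi> / m\<^sup>2)"
    using \<phi> m by (simp add: ln_div ln_realpow algebra_simps)
  ultimately show ?thesis unfolding m_def \<phi>_def by simp
qed

text \<open>
  Let \<open>\<phi> s\<close> be the second moment of \<open>P\<^sub>s h\<close>. Since \<open>P\<^sub>s\<close> preserves the mean,
  \<open>Ent_square_ge\<close> and the log-Sobolev inequality bound \<open>\<phi>' \<le> - \<rho> * \<phi> * ln (\<phi> / (E h)\<^sup>2)\<close>. Thus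
  \<open>\<psi> = ln (\<phi> / (E h)\<^sup>2)\<close> satisfies \<open>\<psi>' \<le> - \<rho> * \<psi>\<close> and decays exponentially, which is the claim after
  exponentiating. Only the second moment is followed, in contrast to hypercontractivity, whose
  exponent varies with time.
\<close>

lemma semigroup_smoothing:
  assumes lsi: "log_sobolev n \<mu> q \<rho>" "0 < \<rho>"
    and h: "\<And>x. x \<in> cube n \<Longrightarrow> 0 \<le> h x" and t: "0 \<le> t"
  shows "E (\<lambda>x. (P t h x)\<^sup>2)
      \<le> ((E h)\<^sup>2) powr (1 - exp (- \<rho> * t)) * (E (\<lambda>x. (h x)\<^sup>2)) powr exp (- \<rho> * t)"
proof -
  define m where "m = E h"
  define \<phi> where "\<phi> s = E (\<lambda>x. (P s h x)\<^sup>2)" for s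
  have \<phi>0: "\<phi> 0 = E (\<lambda>x. (h x)\<^sup>2)" unfolding \<phi>_def by (simp add: semigroup_0)
  have d: "(\<phi> has_real_derivative - 2 * Dirichlet (P s h) (P s h)) (at s)" for s
    unfolding \<phi>_def by (rule energy_has_derivative)
  show ?thesis
  proof (cases "E h = 0")
    case True
    then have "\<forall>x\<in>cube n. pmf \<mu> x * h x = 0"
      unfolding E_def by (subst (asm) sum_nonneg_eq_0_iff) (auto simp: finite_cube h)
    then have "\<phi> 0 = 0" unfolding \<phi>0 E_def by (auto intro!: sum.neutral)
    moreover have "\<phi> t \<le> exp (- 0 * t) * \<phi> 0"
      by (rule gronwall_decay[OF d _ t]) (simp add: Dirichlet_nonneg)
    ultimately have "\<phi> t \<le> 0" by simp
    then show ?thesis unfolding \<phi>_def by (rule order_trans) simp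
  next
    case False
    then have m: "0 < m" using E_nonneg[of h] h by (simp add: m_def less_le)
    have m\<phi>: "m\<^sup>2 \<le> \<phi> s" for s
      using E_square_le[of "P s h"] unfolding m_def \<phi>_def E_semigroup .
    have \<phi>pos: "0 < \<phi> s" for s using m\<phi>[of s] m by (auto intro: less_le_trans[of _ "m\<^sup>2"])
    define \<psi> where "\<psi> s = ln (\<phi> s / m\<^sup>2)" for s
    have d\<psi>: "(\<psi> has_real_derivative - 2 * Dirichlet (P s h) (P s h) / \<phi> s) (at s)" for s
      unfolding \<psi>_def using m \<phi>pos[of s]
      by (auto intro!: derivative_eq_intros d simp: field_simps power2_eq_square power4_eq_xxxx)
    have "- 2 * Dirichlet (P s h) (P s h) / \<phi> s \<le> - \<rho> * \<psi> s" if s: "0 \<le> s" for s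
    proof -
      have "\<rho> * (\<phi> s * \<psi> s) \<le> \<rho> * Ent \<mu> (\<lambda>x. (P s h x)\<^sup>2)"
        using Ent_square_ge[of "P s h"] semigroup_nonneg[OF rates h s] m lsi(2)
        unfolding \<phi>_def \<psi>_def m_def by (intro mult_left_mono) (auto simp: E_semigroup)
      also have "\<dots> \<le> 2 * Dirichlet (P s h) (P s h)" by (rule log_sobolev_Dirichlet[OF lsi])
      finally show ?thesis using \<phi>pos[of s] by (simp add: field_simps)
    qed
    from gronwall_decay[OF d\<psi> this t] have le: "\<psi> t \<le> exp (- \<rho> * t) * \<psi> 0" .
    define e where "e = exp (- \<rho> * t)"
    have "\<phi> t = m\<^sup>2 * exp (\<psi> t)" using m \<phi>pos[of t] by (simp add: \<psi>_def)
    also have "\<dots> \<le> m\<^sup>2 * exp (e * \<psi> 0)" using le by (intro mult_left_mono) (auto simp: e_def)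
    also have "\<dots> = (m\<^sup>2) powr (1 - e) * \<phi> 0 powr e"
    proof -
      have "m\<^sup>2 = exp (ln (m\<^sup>2))" using m by simp
      then have "m\<^sup>2 * exp (e * \<psi> 0) = exp (ln (m\<^sup>2) + e * \<psi> 0)" by (metis exp_add)
      also have "ln (m\<^sup>2) + e * \<psi> 0 = (1 - e) * ln (m\<^sup>2) + e * ln (\<phi> 0)"
        unfolding \<psi>_def using m \<phi>pos[of 0] by (simp add: ln_div algebra_simps)
      finally show ?thesis using m \<phi>pos[of 0] by (simp add: powr_def exp_add)
    qed
    finally show ?thesis unfolding \<phi>0 m_def e_def by (simp only: \<phi>_def)
  qed
qed

text \<open>
  Linearisation of the log-Sobolev inequality at \<open>1 + \<epsilon> g\<close>. The crude bound
  \<open>ln z \<ge> 1 - 1 / z\<close> in the entropy loses a factor \<open>2\<close> against the optimal constant but needs no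
  Taylor expansion.
\<close>

lemma poincare:
  assumes lsi: "log_sobolev n \<mu> q \<rho>" "0 < \<rho>" and g: "E g = 0"
  shows "\<rho> * E (\<lambda>x. (g x)\<^sup>2) \<le> 2 * Dirichlet g g"
proof -
  define \<sigma> where "\<sigma> = E (\<lambda>x. (g x)\<^sup>2)"
  define M where "M = 1 + (\<Sum>x\<in>cube n. \<bar>g x\<bar>)"
  have M: "\<bar>g x\<bar> < M" if "x \<in> cube n" for x
    using member_le_sum[OF that, of "\<lambda>x. \<bar>g x\<bar>"] finite_cube by (auto simp: M_def)
  have M1: "1 \<le> M" unfolding M_def by (simp add: sum_nonneg)
  have "\<rho> * (\<sigma> - \<epsilon>\<^sup>2 * \<sigma>\<^sup>2) \<le> 2 * Dirichlet g g" if \<epsilon>: "0 < \<epsilon>" "\<epsilon> < 1 / M" for \<epsilon>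
  proof -
    define h where "h x = 1 + \<epsilon> * g x" for x
    have h: "0 < h x" if "x \<in> cube n" for x
    proof -
      have "\<epsilon> * \<bar>g x\<bar> \<le> \<epsilon> * M" using M[OF that] \<epsilon> by (intro mult_left_mono) auto
      also have "\<dots> < 1" using \<epsilon> M1 by (simp add: field_simps)
      finally have "\<epsilon> * \<bar>g x\<bar> < 1" .
      moreover have "- (\<epsilon> * g x) \<le> \<epsilon> * \<bar>g x\<bar>" using \<epsilon>(1) by (simp add: abs_if)
      ultimately show ?thesis unfolding h_def by linarith
    qed
    have Eh2: "E (\<lambda>x. (h x)\<^sup>2) = 1 + \<epsilon>\<^sup>2 * \<sigma>"
    proof -
      have "E (\<lambda>x. (h x)\<^sup>2) = E (\<lambda>x. (1 + (2 * \<epsilon>) * g x) + \<epsilon>\<^sup>2 * (g x)\<^sup>2)"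
        by (rule E_cong) (simp add: h_def power2_eq_square algebra_simps)
      then show ?thesis unfolding E_add E_cmult E_const by (simp add: g \<sigma>_def)
    qed
    have "2 * \<epsilon>\<^sup>2 * \<sigma> = E (\<lambda>x. (2 * \<epsilon>) * g x + (2 * \<epsilon>\<^sup>2) * (g x)\<^sup>2)"
      unfolding E_add E_cmult by (simp add: g \<sigma>_def)
    also have "\<dots> \<le> E (\<lambda>x. (h x)\<^sup>2 * ln ((h x)\<^sup>2))"
    proof (rule E_mono)
      fix x assume x: "x \<in> cube n"
      have "ln (1 / h x) \<le> 1 / h x - 1" using h[OF x] by (intro ln_le_minus_one) auto
      then have "1 - 1 / h x \<le> ln (h x)" using h[OF x] by (simp add: ln_div)
      then have "2 * (h x)\<^sup>2 * (1 - 1 / h x) \<le> 2 * (h x)\<^sup>2 * ln (h x)"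
        by (intro mult_left_mono) auto
      also have "2 * (h x)\<^sup>2 * (1 - 1 / h x) = 2 * h x * (h x - 1)"
        using h[OF x] by (simp add: field_simps power2_eq_square)
      also have "\<dots> = (2 * \<epsilon>) * g x + (2 * \<epsilon>\<^sup>2) * (g x)\<^sup>2"
        by (simp add: h_def power2_eq_square algebra_simps)
      finally show "(2 * \<epsilon>) * g x + (2 * \<epsilon>\<^sup>2) * (g x)\<^sup>2 \<le> (h x)\<^sup>2 * ln ((h x)\<^sup>2)"
        using h[OF x] by (simp add: ln_realpow)
    qed
    also have "\<dots> = Ent \<mu> (\<lambda>x. (h x)\<^sup>2) + (1 + \<epsilon>\<^sup>2 * \<sigma>) * ln (1 + \<epsilon>\<^sup>2 * \<sigma>)"
      unfolding Ent_eq Eh2 by simp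
    also have "\<dots> \<le> Ent \<mu> (\<lambda>x. (h x)\<^sup>2) + (1 + \<epsilon>\<^sup>2 * \<sigma>) * (\<epsilon>\<^sup>2 * \<sigma>)"
    proof -
      have "0 \<le> \<epsilon>\<^sup>2 * \<sigma>" unfolding \<sigma>_def by (intro mult_nonneg_nonneg E_nonneg) auto
      then show ?thesis by (intro add_left_mono mult_left_mono ln_add_one_self_le_self) auto
    qed
    finally have "\<epsilon>\<^sup>2 * (\<sigma> - \<epsilon>\<^sup>2 * \<sigma>\<^sup>2) \<le> Ent \<mu> (\<lambda>x. (h x)\<^sup>2)"
      by (simp add: power2_eq_square algebra_simps)
    then have "\<rho> * (\<epsilon>\<^sup>2 * (\<sigma> - \<epsilon>\<^sup>2 * \<sigma>\<^sup>2)) \<le> \<rho> * Ent \<mu> (\<lambda>x. (h x)\<^sup>2)"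
      using lsi(2) by (intro mult_left_mono) auto
    also have "\<dots> \<le> 2 * Dirichlet h h" by (rule log_sobolev_Dirichlet[OF lsi])
    also have "Dirichlet h h = \<epsilon>\<^sup>2 * Dirichlet g g"
    proof -
      have "h y - h x = \<epsilon> * (g y - g x)" for x y by (simp add: h_def right_diff_distrib)
      then show ?thesis
        unfolding Dirichlet_def E_cmult[symmetric]
        by (simp add: sum_distrib_left power2_eq_square mult_ac)
    qed
    finally have "\<epsilon>\<^sup>2 * (\<rho> * (\<sigma> - \<epsilon>\<^sup>2 * \<sigma>\<^sup>2)) \<le> \<epsilon>\<^sup>2 * (2 * Dirichlet g g)"
      by (simp add: mult_ac)
    then show ?thesis using \<epsilon>(1) by simp
  qed
  then have "eventually (\<lambda>\<epsilon>. \<rho> * (\<sigma> - \<epsilon>\<^sup>2 * \<sigma>\<^sup>2) \<le> 2 * Dirichlet g g) (at_right 0)"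
    using M1 by (intro eventually_at_rightI[of 0 "1 / M"]) auto
  moreover have "((\<lambda>\<epsilon>. \<rho> * (\<sigma> - \<epsilon>\<^sup>2 * \<sigma>\<^sup>2)) \<longlongrightarrow> \<rho> * (\<sigma> - 0\<^sup>2 * \<sigma>\<^sup>2)) (at_right 0)"
    by (intro tendsto_intros)
  ultimately have "\<rho> * (\<sigma> - 0\<^sup>2 * \<sigma>\<^sup>2) \<le> 2 * Dirichlet g g"
    by (intro tendsto_upperbound) (auto simp: trivial_limit_at_right_real)
  then show ?thesis by (simp add: \<sigma>_def)
qed

lemma variance_decay:
  assumes lsi: "log_sobolev n \<mu> q \<rho>" "0 < \<rho>" and g: "E g = 0" and t: "0 \<le> t"
  shows "E (\<lambda>x. (P t g x)\<^sup>2) \<le> exp (- \<rho> * t) * E (\<lambda>x. (g x)\<^sup>2)"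
proof -
  have "E (\<lambda>x. (P t g x)\<^sup>2) \<le> exp (- \<rho> * t) * E (\<lambda>x. (P 0 g x)\<^sup>2)"
  proof (rule gronwall_decay[OF energy_has_derivative _ t])
    fix s :: real
    show "- 2 * Dirichlet (P s g) (P s g) \<le> - \<rho> * E (\<lambda>x. (P s g x)\<^sup>2)"
      using poincare[OF lsi, of "P s g"] by (simp add: E_semigroup g)
  qed
  then show ?thesis by (simp add: semigroup_0)
qed

section \<open>Convexity of the energy along the semigroup\<close>

text \<open>
  The expectation of \<open>P\<^sub>r g * L P\<^sub>r g\<close> is minus the Dirichlet form of \<open>P\<^sub>r g\<close>, and its derivative is
  twice the expectation of \<open>(L P\<^sub>r g)\<^sup>2\<close>.
\<close>

lemma Dirichlet_semigroup_antimono: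
  assumes "s \<le> t"
  shows "Dirichlet (P t g) (P t g) \<le> Dirichlet (P s g) (P s g)"
proof -
  have eq: "Dirichlet (P r g) (P r g) = - E (\<lambda>x. P r g x * P r (L g) x)" for r
  proof -
    have "E (\<lambda>x. P r g x * P r (L g) x) = E (\<lambda>x. P r g x * L (P r g) x)"
      by (rule E_cong) (simp add: semigroup_generator_commute)
    then show ?thesis by (simp add: E_mult_generator)
  qed
  have d: "((\<lambda>r. E (\<lambda>x. P r g x * P r (L g) x)) has_real_derivative
      2 * E (\<lambda>x. (P r (L g) x)\<^sup>2)) (at r)" for r
  proof -
    have "((\<lambda>r. E (\<lambda>x. P r g x * P r (L g) x)) has_real_derivative
        E (\<lambda>x. L (P r g) x * P r (L g) x + L (P r (L g)) x * P r g x)) (at r)"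
      by (intro E_has_derivative DERIV_mult semigroup_deriv)
    moreover have "E (\<lambda>x. L (P r g) x * P r (L g) x + L (P r (L g)) x * P r g x)
        = 2 * E (\<lambda>x. L (P r g) x * P r (L g) x)"
      using generator_symmetric[of "P r g" "P r (L g)"] unfolding E_add by (simp add: mult_ac)
    moreover have "E (\<lambda>x. L (P r g) x * P r (L g) x) = E (\<lambda>x. (P r (L g) x)\<^sup>2)"
      by (rule E_cong) (simp add: semigroup_generator_commute power2_eq_square)
    ultimately show ?thesis by simp
  qed
  have "E (\<lambda>x. P s g x * P s (L g) x) \<le> E (\<lambda>x. P t g x * P t (L g) x)"
    by (rule DERIV_nonneg_imp_nondecreasing[OF assms]) (use d in \<open>force intro!: E_nonneg\<close>)
  then show ?thesis unfolding eq by simp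
qed

text \<open>
  The energy of \<open>P\<^sub>s g\<close> has derivative \<open>- 2\<close> times the Dirichlet form, which is smallest at the end
  of the time interval.
\<close>

lemma Dirichlet_semigroup_le:
  assumes t: "0 < t"
  shows "2 * t * Dirichlet (P t g) (P t g) \<le> E (\<lambda>x. (g x)\<^sup>2)"
proof -
  obtain r where r: "0 < r" "r < t"
    and eq: "E (\<lambda>x. (P t g x)\<^sup>2) - E (\<lambda>x. (P 0 g x)\<^sup>2)
        = (t - 0) * (- 2 * Dirichlet (P r g) (P r g))"
    using MVT2[OF t, of "\<lambda>s. E (\<lambda>x. (P s g x)\<^sup>2)" "\<lambda>s. - 2 * Dirichlet (P s g) (P s g)"]
      energy_has_derivative by metis
  have "2 * t * Dirichlet (P t g) (P t g) \<le> 2 * t * Dirichlet (P r g) (P r g)"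
    using r t by (intro mult_left_mono Dirichlet_semigroup_antimono) auto
  also have "\<dots> = E (\<lambda>x. (g x)\<^sup>2) - E (\<lambda>x. (P t g x)\<^sup>2)" using eq by (simp add: semigroup_0)
  also have "\<dots> \<le> E (\<lambda>x. (g x)\<^sup>2)" by (simp add: E_nonneg)
  finally show ?thesis .
qed

text \<open>
  Midpoint log-convexity: the energy of \<open>P\<^bsub>t/2\<^esub> g\<close> is the inner product of \<open>g\<close> and \<open>P\<^sub>t g\<close>.
\<close>

lemma energy_midpoint:
  "(E (\<lambda>x. (P (t / 2) g x)\<^sup>2))\<^sup>2 \<le> E (\<lambda>x. (g x)\<^sup>2) * E (\<lambda>x. (P t g x)\<^sup>2)"
  using E_mult_semigroup_double[of g "t / 2"] E_Cauchy_Schwarz[of g "P t g"] by simp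

text \<open>
  For the energy \<open>v t\<close> of \<open>P\<^sub>t g\<close> and the ratio \<open>r t = v t / v 0\<close>, if \<open>v 0 > 0\<close>, this says
  \<open>r (t / 2\<^sup>k) \<le> r t\<close> to the power \<open>1 / 2\<^sup>k\<close>, without roots and divisions. It is log-convexity
  restricted to dyadic fractions of the time interval, and these are enough.
\<close>

lemma energy_dyadic:
  "(E (\<lambda>x. (P (t / 2 ^ k) g x)\<^sup>2)) ^ 2 ^ k
     \<le> (E (\<lambda>x. (g x)\<^sup>2)) ^ (2 ^ k - 1) * E (\<lambda>x. (P t g x)\<^sup>2)"
proof (induction k)
  case (Suc k)
  let ?v = "\<lambda>s. E (\<lambda>x. (P s g x)\<^sup>2)" and ?V = "E (\<lambda>x. (g x)\<^sup>2)"
  have nn: "0 \<le> ?v s" "0 \<le> ?V" for s by (auto intro: E_nonneg)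
  have "(?v (t / 2 ^ Suc k)) ^ 2 ^ Suc k = ((?v (t / 2 ^ k / 2))\<^sup>2) ^ 2 ^ k"
    by (simp add: power_mult[symmetric] mult.commute)
  also have "\<dots> \<le> (?V * ?v (t / 2 ^ k)) ^ 2 ^ k" by (intro power_mono energy_midpoint) auto
  also have "\<dots> \<le> ?V ^ 2 ^ k * (?V ^ (2 ^ k - 1) * ?v t)"
    unfolding power_mult_distrib using Suc.IH nn by (intro mult_left_mono) auto
  also have "\<dots> = ?V ^ (2 ^ Suc k - 1) * ?v t"
    by (simp add: mult.assoc[symmetric] power_add[symmetric] mult_2)
  finally show ?case .
qed simp

end

section \<open>Gradient estimates\<close>

text \<open>
  Hoelder's inequality for the exponents \<open>1 / \<theta>\<close> and \<open>1 / (1 - \<theta>)\<close>: normalise both sums to \<open>1\<close> and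
  apply Young's inequality to each term.
\<close>

lemma sum_powr_Holder:
  fixes a c :: "'i \<Rightarrow> real"
  assumes I: "finite I" and a: "\<And>i. i \<in> I \<Longrightarrow> 0 \<le> a i" and c: "\<And>i. i \<in> I \<Longrightarrow> 0 \<le> c i"
    and \<theta>: "0 < \<theta>" "\<theta> < 1"
  shows "(\<Sum>i\<in>I. a i powr \<theta> * c i powr (1 - \<theta>)) \<le> (\<Sum>i\<in>I. a i) powr \<theta> * (\<Sum>i\<in>I. c i) powr (1 - \<theta>)"
proof -
  define A C where "A = (\<Sum>i\<in>I. a i)" and "C = (\<Sum>i\<in>I. c i)"
  show ?thesis
  proof (cases "A = 0 \<or> C = 0")
    case True
    then have "\<forall>i\<in>I. a i = 0 \<or> c i = 0"
      unfolding A_def C_def using sum_nonneg_eq_0_iff[OF I] a c by metis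
    then have "(\<Sum>i\<in>I. a i powr \<theta> * c i powr (1 - \<theta>)) = 0"
      by (intro sum.neutral) auto
    then show ?thesis by simp
  next
    case False
    then have pos: "0 < A" "0 < C"
      unfolding A_def C_def by (simp_all add: less_le sum_nonneg a c)
    have "a i powr \<theta> * c i powr (1 - \<theta>)
        \<le> A powr \<theta> * C powr (1 - \<theta>) * (\<theta> * (a i / A) + (1 - \<theta>) * (c i / C))" if i: "i \<in> I" for i
    proof (cases "a i = 0 \<or> c i = 0")
      case True
      then have "a i powr \<theta> * c i powr (1 - \<theta>) = 0" by auto
      also have "0 \<le> A powr \<theta> * C powr (1 - \<theta>) * (\<theta> * (a i / A) + (1 - \<theta>) * (c i / C))"
        using pos \<theta> a[OF i] c[OF i] by (intro mult_nonneg_nonneg add_nonneg_nonneg) auto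
      finally show ?thesis .
    next
      case False
      then have aci: "0 < a i" "0 < c i" using a[OF i] c[OF i] by auto
      have "a i powr \<theta> * c i powr (1 - \<theta>)
          = A powr \<theta> * C powr (1 - \<theta>) * ((a i / A) powr \<theta> * (c i / C) powr (1 - \<theta>))"
        using pos aci by (simp add: powr_divide)
      also have "\<dots> \<le> A powr \<theta> * C powr (1 - \<theta>) * (\<theta> * (a i / A) + (1 - \<theta>) * (c i / C))"
        using pos aci \<theta> by (intro mult_left_mono Youngs_inequality_0) auto
      finally show ?thesis .
    qed
    then have "(\<Sum>i\<in>I. a i powr \<theta> * c i powr (1 - \<theta>))
        \<le> (\<Sum>i\<in>I. A powr \<theta> * C powr (1 - \<theta>) * (\<theta> * (a i / A) + (1 - \<theta>) * (c i / C)))"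
      by (rule sum_mono)
    also have "\<dots> = A powr \<theta> * C powr (1 - \<theta>) * (\<theta> * (A / A) + (1 - \<theta>) * (C / C))"
      unfolding A_def C_def
      by (simp only: sum_distrib_left[symmetric] sum.distrib sum_divide_distrib[symmetric])
    also have "\<dots> = A powr \<theta> * C powr (1 - \<theta>)" using pos by simp
    finally show ?thesis unfolding A_def C_def .
  qed
qed

locale weighted_cube = reversible_cube +
  fixes w :: vfield and b :: real
  assumes b: "0 < b" "b \<le> 1" and weights: "bounded_weights n b w"
begin

abbreviation grad_norm :: "(point \<Rightarrow> real) \<Rightarrow> point \<Rightarrow> real" where
  "grad_norm f x \<equiv> L2_set (\<lambda>i. grad q w f i x) {1..n}"

lemma weight_bounds:
  assumes "i \<in> {1..n}" "x \<in> cube n"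
  shows "b \<le> w i x" "b * w i x \<le> 1" "0 \<le> w i x"
  using weights assms b by (auto simp: bounded_weights_def field_simps intro: order_trans[of 0 b])

lemma grad_square:
  assumes "i \<in> {1..n}" "x \<in> cube n"
  shows "(grad q w f i x)\<^sup>2 = w i x * (1 / 2 * q i x * (f (flip i x) - f x)\<^sup>2)"
  unfolding grad_def power_mult_distrib
  using weight_bounds[OF assms] rate_nonneg[OF assms] by simp

lemma grad_norm_square: "(grad_norm f x)\<^sup>2 = (\<Sum>i=1..n. (grad q w f i x)\<^sup>2)"
  unfolding L2_set_def by (simp add: sum_nonneg)

lemma Gamma_eq_sum: "Gamma_op n q f x = (\<Sum>i=1..n. 1 / 2 * q i x * (f (flip i x) - f x)\<^sup>2)"
  unfolding Gamma_op_def by (simp add: sum_distrib_left mult_ac)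

lemma Gamma_ge_grad_norm:
  assumes x: "x \<in> cube n"
  shows "b * (grad_norm f x)\<^sup>2 \<le> Gamma_op n q f x"
  unfolding grad_norm_square Gamma_eq_sum sum_distrib_left
proof (rule sum_mono)
  fix i assume i: "i \<in> {1..n}"
  have "(b * w i x) * (1 / 2 * q i x * (f (flip i x) - f x)\<^sup>2) \<le> 1 * (1 / 2 * q i x * (f (flip i x) - f x)\<^sup>2)"
    using rate_nonneg[OF i x] by (intro mult_right_mono weight_bounds i x) auto
  then show "b * (grad q w f i x)\<^sup>2 \<le> 1 / 2 * q i x * (f (flip i x) - f x)\<^sup>2"
    unfolding grad_square[OF i x] by (simp add: mult.assoc)
qed

lemma Gamma_le_grad_norm:
  assumes x: "x \<in> cube n"
  shows "b * Gamma_op n q f x \<le> (grad_norm f x)\<^sup>2"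
  unfolding grad_norm_square Gamma_eq_sum sum_distrib_left
proof (rule sum_mono)
  fix i assume i: "i \<in> {1..n}"
  show "b * (1 / 2 * q i x * (f (flip i x) - f x)\<^sup>2) \<le> (grad q w f i x)\<^sup>2"
    unfolding grad_square[OF i x]
    using rate_nonneg[OF i x] by (intro mult_right_mono weight_bounds i x) auto
qed

lemma grad_norm_cong:
  assumes "\<And>y. y \<in> cube n \<Longrightarrow> f y = g y" "x \<in> cube n"
  shows "grad_norm f x = grad_norm g x"
  unfolding grad_def by (rule L2_set_cong) (simp_all add: assms flip_in_cube)

lemma grad_norm_semigroup_le:
  assumes csge: "CSGE_0 n q w \<rho>" and t: "0 \<le> t" "t \<le> 1" and x: "x \<in> cube n"
  shows "(grad_norm (P t f) x)\<^sup>2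
    \<le> exp (2 * \<bar>\<rho>\<bar>) * (\<Sum>i=1..n. (P t (abs_grad q w f i) x)\<^sup>2)"
proof -
  define S where "S = L2_set (\<lambda>i. P t (abs_grad q w f i) x) {1..n}"
  have S0: "0 \<le> S" unfolding S_def by simp
  have "- \<rho> * t \<le> \<bar>\<rho>\<bar> * 1"
  proof -
    have "- \<rho> * t \<le> \<bar>\<rho>\<bar> * t" using t by (intro mult_right_mono) auto
    also have "\<dots> \<le> \<bar>\<rho>\<bar> * 1" using t by (intro mult_left_mono) auto
    finally show ?thesis .
  qed
  then have "exp (- \<rho> * t) * S \<le> exp \<bar>\<rho>\<bar> * S" using S0 by (intro mult_right_mono) auto
  moreover have "grad_norm (P t f) x \<le> exp (- \<rho> * t) * S"
    using csge t x unfolding CSGE_0_def S_def by blast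
  ultimately have "grad_norm (P t f) x \<le> exp \<bar>\<rho>\<bar> * S" by linarith
  then have "(grad_norm (P t f) x)\<^sup>2 \<le> (exp \<bar>\<rho>\<bar> * S)\<^sup>2" by (intro power_mono) auto
  also have "\<dots> = exp (2 * \<bar>\<rho>\<bar>) * S\<^sup>2" by (simp add: power_mult_distrib exp_double)
  also have "S\<^sup>2 = (\<Sum>i=1..n. (P t (abs_grad q w f i) x)\<^sup>2)"
    unfolding S_def L2_set_def by (simp add: sum_nonneg)
  finally show ?thesis .
qed

text \<open>
  Interpolate from \<open>(P\<^sub>s f)\<^sup>2\<close> to \<open>P\<^sub>s (f\<^sup>2)\<close> by \<open>F u = P\<^sub>u ((P\<^bsub>s-u\<^esub> f)\<^sup>2)\<close>, which increases by at most \<open>1\<close>.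
  Its derivative is \<open>2 P\<^sub>u (\<Gamma> (P\<^bsub>s-u\<^esub> f))\<close>. By Jensen's inequality in each coordinate and the
  \<open>0\<close>-CSGE over time \<open>u\<close>, it is at least a constant times the squared gradient of
  \<open>P\<^sub>u P\<^bsub>s-u\<^esub> f = P\<^sub>s f\<close>, which does not depend on \<open>u\<close>.
\<close>

lemma reverse_poincare:
  assumes csge: "CSGE_0 n q w \<rho>" and s: "0 \<le> s" "s \<le> 1" and x: "x \<in> cube n"
    and f: "\<And>y. y \<in> cube n \<Longrightarrow> (f y)\<^sup>2 \<le> 1"
  shows "2 * b * s * (grad_norm (P s f) x)\<^sup>2 \<le> exp (2 * \<bar>\<rho>\<bar>)"
proof -
  define G where "G = (grad_norm (P s f) x)\<^sup>2"
  define F where "F u = P u (\<lambda>y. (P (s - u) f y)\<^sup>2) x" for u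
  define F' where "F' u = P u (\<lambda>y. 2 * Gamma_op n q (P (s - u) f) y) x" for u
  define k where "k = 2 * b * exp (- 2 * \<bar>\<rho>\<bar>) * G"
  have d: "(F has_real_derivative F' u) (at u)" for u
  proof -
    have "(F has_real_derivative
        1 * P u (L (\<lambda>y. (P (s - u) f y)\<^sup>2)) x
        + P u (\<lambda>y. 2 * (P (s - u) f y * - L (P (s - u) f) y)) x) (at u)"
      unfolding F_def
      by (rule semigroup_chain_rule[OF x])
         (auto intro!: derivative_eq_intros semigroup_deriv_reflect)
    also have "1 * P u (L (\<lambda>y. (P (s - u) f y)\<^sup>2)) x
        + P u (\<lambda>y. 2 * (P (s - u) f y * - L (P (s - u) f) y)) x
        = P u (\<lambda>y. 1 * L (\<lambda>y. (P (s - u) f y)\<^sup>2) y + 1 * (2 * (P (s - u) f y * - L (P (s - u) f) y))) x"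
      by (simp only: semigroup_linear[OF x])
    also have "\<dots> = F' u"
      unfolding F'_def generator_square by (simp add: mult_ac)
    finally show ?thesis .
  qed
  have "k \<le> F' u" if u: "0 \<le> u" "u \<le> s" for u
  proof -
    let ?g = "P (s - u) f"
    have "G = (grad_norm (P u ?g) x)\<^sup>2"
      unfolding G_def using semigroup_add[of _ n q u "s - u" f]
      by (subst grad_norm_cong[OF _ x, of "P s f" "P u ?g"]) auto
    also have "\<dots> \<le> exp (2 * \<bar>\<rho>\<bar>) * (\<Sum>i=1..n. (P u (abs_grad q w ?g i) x)\<^sup>2)"
      using u s by (intro grad_norm_semigroup_le csge x) auto
    also have "\<dots> \<le> exp (2 * \<bar>\<rho>\<bar>) * (\<Sum>i=1..n. P u (\<lambda>y. (abs_grad q w ?g i y)\<^sup>2) x)"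
      using u by (intro mult_left_mono sum_mono semigroup_square_le x) auto
    finally have "k \<le> 2 * b * exp (- 2 * \<bar>\<rho>\<bar>)
        * (exp (2 * \<bar>\<rho>\<bar>) * (\<Sum>i=1..n. P u (\<lambda>y. (abs_grad q w ?g i y)\<^sup>2) x))"
      unfolding k_def using b by (intro mult_left_mono) auto
    also have "\<dots> = 2 * b * (exp (- 2 * \<bar>\<rho>\<bar>) * exp (2 * \<bar>\<rho>\<bar>))
        * (\<Sum>i=1..n. P u (\<lambda>y. (abs_grad q w ?g i y)\<^sup>2) x)"
      by (simp only: mult.assoc)
    also have "\<dots> = (\<Sum>i=1..n. 2 * b * P u (\<lambda>y. (abs_grad q w ?g i y)\<^sup>2) x)"
      by (simp add: exp_add[symmetric] sum_distrib_left)
    also have "\<dots> = P u (\<lambda>y. \<Sum>i=1..n. 2 * b * (abs_grad q w ?g i y)\<^sup>2) x"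
      by (rule semigroup_sum[OF _ x, symmetric]) simp
    also have "\<dots> \<le> F' u"
      unfolding F'_def
    proof (rule semigroup_mono[OF _ u(1) x])
      fix y assume "y \<in> cube n"
      from Gamma_ge_grad_norm[OF this, of ?g]
      show "(\<Sum>i=1..n. 2 * b * (abs_grad q w ?g i y)\<^sup>2) \<le> 2 * Gamma_op n q ?g y"
        unfolding grad_norm_square abs_grad_def by (simp add: sum_distrib_left[symmetric])
    qed
    finally show ?thesis .
  qed
  then have "F 0 - k * 0 \<le> F s - k * s"
    by (intro DERIV_nonneg_imp_nondecreasing[OF s(1), of "\<lambda>u. F u - k * u"])
       (use d in \<open>fastforce intro!: derivative_eq_intros\<close>)
  moreover have "0 \<le> F 0" unfolding F_def by (simp add: semigroup_0)
  moreover have "F s \<le> 1"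
    unfolding F_def using semigroup_bounded[OF f s(1) x] by (simp add: semigroup_0)
  ultimately have "k * s \<le> 1" by simp
  then have "exp (2 * \<bar>\<rho>\<bar>) * (k * s) \<le> exp (2 * \<bar>\<rho>\<bar>) * 1" by (intro mult_left_mono) auto
  then show ?thesis unfolding k_def G_def by (simp add: exp_minus field_simps)
qed

lemma Dirichlet_le_grad_norm:
  "b * Dirichlet f g \<le> E (\<lambda>x. grad_norm f x * grad_norm g x)"
  unfolding Dirichlet_def E_cmult[symmetric]
proof (rule E_mono)
  fix x assume x: "x \<in> cube n"
  have "b * (\<Sum>i=1..n. 1 / 2 * q i x * (f (flip i x) - f x) * (g (flip i x) - g x))
      \<le> (\<Sum>i=1..n. \<bar>grad q w f i x\<bar> * \<bar>grad q w g i x\<bar>)"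
    unfolding sum_distrib_left
  proof (rule sum_mono)
    fix i assume i: "i \<in> {1..n}"
    let ?a = "1 / 2 * q i x" and ?d = "(f (flip i x) - f x) * (g (flip i x) - g x)"
    note wb = weight_bounds[OF i x] and q0 = rate_nonneg[OF i x]
    have "b * (?a * (f (flip i x) - f x) * (g (flip i x) - g x)) \<le> b * (?a * \<bar>?d\<bar>)"
      unfolding mult.assoc[of ?a] using b q0 by (intro mult_left_mono) auto
    also have "\<dots> \<le> w i x * (?a * \<bar>?d\<bar>)" using wb q0 by (intro mult_right_mono) auto
    also have "\<dots> = sqrt (1 / 2 * w i x * q i x) * sqrt (1 / 2 * w i x * q i x) * \<bar>?d\<bar>"
      using wb q0 by simp
    also have "\<dots> = \<bar>grad q w f i x\<bar> * \<bar>grad q w g i x\<bar>"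
      unfolding grad_def abs_mult using wb q0 by (simp only: mult_ac abs_of_nonneg real_sqrt_ge_zero mult_nonneg_nonneg)
    finally show "b * (1 / 2 * q i x * (f (flip i x) - f x) * (g (flip i x) - g x))
        \<le> \<bar>grad q w f i x\<bar> * \<bar>grad q w g i x\<bar>" .
  qed
  also have "\<dots> \<le> grad_norm f x * grad_norm g x" by (rule L2_set_mult_ineq)
  finally show "b * (\<Sum>i=1..n. 1 / 2 * q i x * (f (flip i x) - f x) * (g (flip i x) - g x))
      \<le> grad_norm f x * grad_norm g x" .
qed

lemma A_fun_eq: "A_fun n \<mu> q w f = E (grad_norm f)"
  unfolding A_fun_def expectation_eq_E ..

text \<open>
  The Dirichlet form pairs the gradient of \<open>f\<close>, measured in mean, with that of \<open>P\<^sub>s f\<close>, measured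
  uniformly by \<open>reverse_poincare\<close>.
\<close>

lemma Dirichlet_semigroup_le_A:
  assumes csge: "CSGE_0 n q w \<rho>" and s: "0 < s" "s \<le> 1"
    and f: "\<And>y. y \<in> cube n \<Longrightarrow> (f y)\<^sup>2 \<le> 1"
  shows "Dirichlet f (P s f) \<le> exp \<bar>\<rho>\<bar> / (b * sqrt (2 * b)) * A_fun n \<mu> q w f / sqrt s"
proof -
  define K where "K = exp \<bar>\<rho>\<bar> / (sqrt (2 * b) * sqrt s)"
  have K: "grad_norm (P s f) x \<le> K" if x: "x \<in> cube n" for x
  proof (rule power2_le_imp_le)
    have "2 * b * s * (grad_norm (P s f) x)\<^sup>2 \<le> exp (2 * \<bar>\<rho>\<bar>)"
      using s by (intro reverse_poincare csge x f) auto
    moreover have "K\<^sup>2 = exp (2 * \<bar>\<rho>\<bar>) / (2 * b * s)"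
      unfolding K_def power_divide power_mult_distrib exp_double[symmetric] using b s by simp
    ultimately have "2 * b * s * (grad_norm (P s f) x)\<^sup>2 \<le> 2 * b * s * K\<^sup>2"
      using b s by simp
    then show "(grad_norm (P s f) x)\<^sup>2 \<le> K\<^sup>2"
      by (rule mult_left_le_imp_le) (use b s in auto)
    show "0 \<le> K" unfolding K_def using b s by simp
  qed
  have "b * Dirichlet f (P s f) \<le> E (\<lambda>x. grad_norm f x * grad_norm (P s f) x)"
    by (rule Dirichlet_le_grad_norm)
  also have "\<dots> \<le> E (\<lambda>x. K * grad_norm f x)"
    by (rule E_mono) (subst mult.commute, intro mult_right_mono K, auto)
  also have "\<dots> = K * A_fun n \<mu> q w f" by (simp add: E_cmult A_fun_eq)
  finally have "Dirichlet f (P s f) \<le> K * A_fun n \<mu> q w f / b"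
    using b by (simp add: field_simps)
  then show ?thesis unfolding K_def by (simp add: field_simps)
qed

text \<open>
  The left-hand side is the integral over \<open>s \<le> t\<close> of the Dirichlet form of \<open>f\<close> and \<open>P\<^sub>s f\<close>, hence at
  most the integral of the bound in \<open>Dirichlet_semigroup_le_A\<close>. The square root is not
  differentiable at \<open>0\<close>, so the comparison of derivatives takes place on the open interval.
\<close>

lemma noise_stability_ge:
  assumes csge: "CSGE_0 n q w \<rho>" and t: "0 \<le> t" "t \<le> 1"
    and f: "\<And>y. y \<in> cube n \<Longrightarrow> (f y)\<^sup>2 \<le> 1"
  shows "E (\<lambda>x. (f x)\<^sup>2) - E (\<lambda>x. f x * P t f x)
    \<le> 2 * exp \<bar>\<rho>\<bar> / (b * sqrt (2 * b)) * sqrt t * A_fun n \<mu> q w f"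
proof -
  define K where "K = exp \<bar>\<rho>\<bar> / (b * sqrt (2 * b)) * A_fun n \<mu> q w f"
  have d: "((\<lambda>s. E (\<lambda>x. f x * P s f x)) has_real_derivative - Dirichlet f (P s f)) (at s)" for s
    unfolding E_mult_generator[symmetric]
    by (intro E_has_derivative DERIV_cmult semigroup_deriv)
  have "2 * K * sqrt 0 + E (\<lambda>x. f x * P 0 f x) \<le> 2 * K * sqrt t + E (\<lambda>x. f x * P t f x)"
  proof (rule DERIV_nonneg_imp_increasing_open[OF t(1)])
    fix s assume s: "0 < s" "s < t"
    have "((\<lambda>s. 2 * K * sqrt s + E (\<lambda>x. f x * P s f x)) has_real_derivative
        K / sqrt s - Dirichlet f (P s f)) (at s)"
      using s by (auto intro!: derivative_eq_intros d simp: field_simps)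
    moreover have "0 \<le> K / sqrt s - Dirichlet f (P s f)"
      using Dirichlet_semigroup_le_A[OF csge s(1) _ f] s t unfolding K_def by auto
    ultimately show "\<exists>y. ((\<lambda>s. 2 * K * sqrt s + E (\<lambda>x. f x * P s f x)) has_real_derivative y) (at s) \<and> 0 \<le> y"
      by blast
  next
    show "continuous_on {0..t} (\<lambda>s. 2 * K * sqrt s + E (\<lambda>x. f x * P s f x))"
      by (intro continuous_intros DERIV_continuous_on[OF has_field_derivative_at_within[OF d]])
  qed
  then show ?thesis unfolding K_def by (simp add: semigroup_0 power2_eq_square mult_ac)
qed

lemma J_fun_eq: "J_fun n \<mu> q w f = (\<Sum>i=1..n. (E (abs_grad q w f i))\<^sup>2)"
  unfolding J_fun_def expectation_eq_E abs_grad_def ..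

lemma J_semigroup_le:
  assumes csge: "CSGE_inf n \<mu> q w \<rho>" and t: "0 \<le> t" "t \<le> 1"
  shows "J_fun n \<mu> q w (P t f) \<le> exp (2 * \<bar>\<rho>\<bar>) * J_fun n \<mu> q w f"
proof -
  have eq: "J_fun n \<mu> q w f = (L2_set (\<lambda>i. E (abs_grad q w f i)) {1..n})\<^sup>2" for f
    unfolding J_fun_eq L2_set_def by (simp add: sum_nonneg)
  let ?S = "L2_set (\<lambda>i. E (abs_grad q w f i)) {1..n}"
  have "- \<rho> * t \<le> \<bar>\<rho>\<bar> * t" using t by (intro mult_right_mono) auto
  also have "\<dots> \<le> \<bar>\<rho>\<bar> * 1" using t by (intro mult_left_mono) auto
  finally have "exp (- \<rho> * t) * ?S \<le> exp \<bar>\<rho>\<bar> * ?S" by (intro mult_right_mono) auto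
  moreover have "L2_set (\<lambda>i. E (abs_grad q w (P t f) i)) {1..n} \<le> exp (- \<rho> * t) * ?S"
    using csge t unfolding CSGE_inf_def expectation_eq_E by blast
  ultimately have "L2_set (\<lambda>i. E (abs_grad q w (P t f) i)) {1..n} \<le> exp \<bar>\<rho>\<bar> * ?S" by linarith
  then have "J_fun n \<mu> q w (P t f) \<le> (exp \<bar>\<rho>\<bar> * ?S)\<^sup>2"
    unfolding eq by (intro power_mono) auto
  then show ?thesis unfolding eq by (simp add: power_mult_distrib exp_double)
qed

text \<open>
  Split \<open>P\<^bsub>2\<tau>\<^esub> g = P\<^sub>\<tau> u\<close> with \<open>u = P\<^sub>\<tau> g\<close>. The Poincare inequality and the \<open>0\<close>-CSGE reduce the energy
  to the second moments of \<open>P\<^sub>\<tau>\<close> applied to the absolute partial derivatives of \<open>u\<close>, and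
  \<open>semigroup_smoothing\<close> interpolates these between first and second moments. The first moments of the
  derivatives of \<open>u\<close> are controlled by \<open>J\<close> through the \<open>\<infinity>\<close>-CSGE, the second moments by the variance
  through \<open>Dirichlet_semigroup_le\<close>, and Hoelder's inequality sums over the coordinates.
\<close>

lemma energy_le_J:
  assumes csge0: "CSGE_0 n q w \<rho>" and csge: "CSGE_inf n \<mu> q w \<rho>"
    and lsi: "log_sobolev n \<mu> q \<rho>L" "0 < \<rho>L"
    and \<tau>: "0 < \<tau>" "\<tau> \<le> 1 / 2" and g: "E g = 0"
  shows "\<rho>L * \<tau> * b\<^sup>2 * E (\<lambda>x. (P (2 * \<tau>) g x)\<^sup>2)
    \<le> exp (2 * \<bar>\<rho>\<bar>) ^ 2 * J_fun n \<mu> q w g powr (1 - exp (- \<rho>L * \<tau>))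
        * E (\<lambda>x. (g x)\<^sup>2) powr exp (- \<rho>L * \<tau>)"
proof -
  define \<theta> where "\<theta> = 1 - exp (- \<rho>L * \<tau>)"
  define D where "D = exp (2 * \<bar>\<rho>\<bar>)"
  define J where "J = J_fun n \<mu> q w g"
  define V where "V = E (\<lambda>x. (g x)\<^sup>2)"
  define u where "u = P \<tau> g"
  have \<theta>: "0 < \<theta>" "\<theta> < 1" unfolding \<theta>_def using lsi(2) \<tau>(1) by auto
  have D: "1 \<le> D" unfolding D_def by simp
  have J: "0 \<le> J" unfolding J_def J_fun_eq by (intro sum_nonneg) auto
  have V: "0 \<le> V" unfolding V_def by (intro E_nonneg) auto
  have ag: "0 \<le> abs_grad q w u i x" for i x by (simp add: abs_grad_def)
  have second_moment: "(\<Sum>i=1..n. E (\<lambda>x. (abs_grad q w u i x)\<^sup>2)) \<le> V / (2 * \<tau> * b)"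
  proof -
    have "b * (\<Sum>i=1..n. E (\<lambda>x. (abs_grad q w u i x)\<^sup>2)) = E (\<lambda>x. b * (grad_norm u x)\<^sup>2)"
      unfolding E_sum[symmetric] E_cmult grad_norm_square by (simp add: abs_grad_def)
    also have "\<dots> \<le> Dirichlet u u"
      unfolding Dirichlet_Gamma by (intro E_mono Gamma_ge_grad_norm)
    also have "\<dots> \<le> V / (2 * \<tau>)"
      using Dirichlet_semigroup_le[OF \<tau>(1), of g] \<tau>(1) unfolding u_def V_def
      by (simp add: field_simps)
    finally have "b * (\<Sum>i=1..n. E (\<lambda>x. (abs_grad q w u i x)\<^sup>2)) \<le> b * (V / (2 * \<tau> * b))"
      using b by simp
    then show ?thesis using b(1) by (rule mult_left_le_imp_le)
  qed
  have "E (\<lambda>x. (grad_norm (P \<tau> u) x)\<^sup>2) \<le> E (\<lambda>x. D * (\<Sum>i=1..n. (P \<tau> (abs_grad q w u i) x)\<^sup>2))"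
    unfolding D_def using \<tau> by (intro E_mono grad_norm_semigroup_le csge0) auto
  also have "\<dots> = D * (\<Sum>i=1..n. E (\<lambda>x. (P \<tau> (abs_grad q w u i) x)\<^sup>2))"
    unfolding E_cmult E_sum ..
  also have "\<dots> \<le> D * (\<Sum>i=1..n. ((E (abs_grad q w u i))\<^sup>2) powr \<theta>
        * (E (\<lambda>x. (abs_grad q w u i x)\<^sup>2)) powr (1 - \<theta>))"
    using semigroup_smoothing[OF lsi ag, of \<tau>] \<tau> D
    unfolding \<theta>_def by (intro mult_left_mono sum_mono) auto
  also have "\<dots> \<le> D * ((\<Sum>i=1..n. (E (abs_grad q w u i))\<^sup>2) powr \<theta>
        * (\<Sum>i=1..n. E (\<lambda>x. (abs_grad q w u i x)\<^sup>2)) powr (1 - \<theta>))"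
    using D \<theta> by (intro mult_left_mono sum_powr_Holder) (auto intro: E_nonneg)
  also have "\<dots> \<le> D * ((D * J) powr \<theta> * (V / (2 * \<tau> * b)) powr (1 - \<theta>))"
  proof (intro mult_left_mono mult_mono powr_mono2 second_moment)
    show "(\<Sum>i=1..n. (E (abs_grad q w u i))\<^sup>2) \<le> D * J"
      using J_semigroup_le[OF csge, of \<tau> g] \<tau> unfolding u_def J_def D_def J_fun_eq by simp
  qed (use \<theta> D in \<open>auto intro!: sum_nonneg E_nonneg\<close>)
  also have "\<dots> = D * (D powr \<theta> * (1 / (2 * \<tau> * b)) powr (1 - \<theta>)) * (J powr \<theta> * V powr (1 - \<theta>))"
    using D J V \<tau> b by (simp add: powr_mult powr_divide)
  also have "\<dots> \<le> D * (D powr 1 * (1 / (2 * \<tau> * b)) powr 1) * (J powr \<theta> * V powr (1 - \<theta>))"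
  proof (intro mult_right_mono mult_left_mono mult_mono powr_mono)
    have "2 * \<tau> * b \<le> 1 * 1" using \<tau> b by (intro mult_mono) auto
    then show "1 \<le> 1 / (2 * \<tau> * b)" using \<tau> b by simp
  qed (use \<theta> D in auto)
  also have "\<dots> = D\<^sup>2 * J powr \<theta> * V powr (1 - \<theta>) / (2 * \<tau> * b)"
    using D \<tau> b by (simp add: power2_eq_square)
  finally have grad: "E (\<lambda>x. (grad_norm (P \<tau> u) x)\<^sup>2) \<le> D\<^sup>2 * J powr \<theta> * V powr (1 - \<theta>) / (2 * \<tau> * b)" .
  have E2: "E (\<lambda>x. (P (2 * \<tau>) g x)\<^sup>2) = E (\<lambda>x. (P \<tau> u x)\<^sup>2)"
    unfolding u_def by (rule E_cong) (simp only: mult_2 semigroup_add)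
  have "b * (\<rho>L * E (\<lambda>x. (P \<tau> u x)\<^sup>2)) \<le> b * (2 * Dirichlet (P \<tau> u) (P \<tau> u))"
    using b by (intro mult_left_mono poincare lsi) (auto simp: E_semigroup u_def g)
  also have "\<dots> = 2 * E (\<lambda>x. b * Gamma_op n q (P \<tau> u) x)"
    by (simp add: Dirichlet_Gamma E_cmult)
  also have "\<dots> \<le> 2 * E (\<lambda>x. (grad_norm (P \<tau> u) x)\<^sup>2)"
    by (intro mult_left_mono E_mono Gamma_le_grad_norm) auto
  also have "\<dots> \<le> 2 * (D\<^sup>2 * J powr \<theta> * V powr (1 - \<theta>) / (2 * \<tau> * b))"
    using grad by simp
  finally have "\<tau> * b * (b * (\<rho>L * E (\<lambda>x. (P \<tau> u x)\<^sup>2)))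
      \<le> \<tau> * b * (2 * (D\<^sup>2 * J powr \<theta> * V powr (1 - \<theta>) / (2 * \<tau> * b)))"
    using \<tau> b by (intro mult_left_mono) auto
  also have "\<dots> = D\<^sup>2 * J powr \<theta> * V powr (1 - \<theta>)" using \<tau> b by simp
  finally show ?thesis
    unfolding E2 unfolding D_def J_def V_def \<theta>_def by (simp add: power2_eq_square mult_ac)
qed

end

section \<open>Sign functions\<close>

context weighted_cube
begin

text \<open>
  For a sign function, \<open>\<bar>f - E f\<bar> = 1 - f * E f\<close>, so the first absolute central moment equals the
  variance. Smoothing therefore gains a power of the variance itself.
\<close>

lemma sign_function_energy_le:
  assumes lsi: "log_sobolev n \<mu> q \<rho>" "0 < \<rho>" and t: "0 \<le> t"
    and f: "\<And>x. x \<in> cube n \<Longrightarrow> f x \<in> {-1, 1}"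
    and g: "\<And>x. g x = f x - E f" and V: "V = E (\<lambda>x. (g x)\<^sup>2)"
  shows "E (\<lambda>x. (P t g x)\<^sup>2) \<le> V powr (2 - exp (- \<rho> * t))"
proof -
  have V0: "0 \<le> V" unfolding V by (intro E_nonneg) auto
  have f2: "(f x)\<^sup>2 = 1" if "x \<in> cube n" for x using f[OF that] by auto
  have "E (\<lambda>x. (f x)\<^sup>2) = 1" using E_cong[of "\<lambda>x. (f x)\<^sup>2" "\<lambda>_. 1"] f2 by (simp add: E_const)
  then have m: "(E f)\<^sup>2 \<le> 1" using E_square_le[of f] by simp
  then have m1: "\<bar>E f\<bar> \<le> 1" by (simp add: abs_square_le_1)
  have "E (\<lambda>x. \<bar>g x\<bar>) = E (\<lambda>x. 1 + (- E f) * f x)"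
  proof (rule E_cong)
    fix x assume x: "x \<in> cube n"
    show "\<bar>g x\<bar> = 1 + (- E f) * f x" 
    proof (cases "f x = 1")
      case True
      then show ?thesis using m1 by (simp add: g)
    next
      case False
      then have "f x = -1" using f[OF x] by simp
      then show ?thesis using m1 by (simp add: g)
    qed
  qed
  moreover have "V = E (\<lambda>x. (1 + (E f)\<^sup>2) + (- 2 * E f) * f x)"
    unfolding V
  proof (rule E_cong)
    fix x assume "x \<in> cube n"
    from f2[OF this] show "(g x)\<^sup>2 = (1 + (E f)\<^sup>2) + (- 2 * E f) * f x"
      by (simp add: g power2_diff)
  qed
  ultimately have first: "E (\<lambda>x. \<bar>g x\<bar>) = V"
    unfolding E_add E_cmult E_const by (simp add: power2_eq_square)
  have "E (\<lambda>x. (P t g x)\<^sup>2) \<le> E (\<lambda>x. (P t (\<lambda>y. \<bar>g y\<bar>) x)\<^sup>2)"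
  proof (rule E_mono)
    fix x assume x: "x \<in> cube n"
    have "P t g x \<le> P t (\<lambda>y. \<bar>g y\<bar>) x" by (rule semigroup_mono[OF _ t x]) simp
    moreover have "P t (\<lambda>y. (-1) * g y + 0 * g y) x \<le> P t (\<lambda>y. \<bar>g y\<bar>) x"
      by (rule semigroup_mono[OF _ t x]) simp
    ultimately have "\<bar>P t g x\<bar> \<le> P t (\<lambda>y. \<bar>g y\<bar>) x"
      unfolding semigroup_linear[OF x] by simp
    then have "\<bar>P t g x\<bar>\<^sup>2 \<le> (P t (\<lambda>y. \<bar>g y\<bar>) x)\<^sup>2" by (intro power_mono) auto
    then show "(P t g x)\<^sup>2 \<le> (P t (\<lambda>y. \<bar>g y\<bar>) x)\<^sup>2" by simp
  qed
  also have "\<dots> \<le> (V\<^sup>2) powr (1 - exp (- \<rho> * t)) * V powr exp (- \<rho> * t)"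
    using semigroup_smoothing[OF lsi, of "\<lambda>x. \<bar>g x\<bar>" t] t by (simp add: first V)
  also have "\<dots> = V powr (2 - exp (- \<rho> * t))"
  proof (cases "V = 0")
    case False
    then have "V\<^sup>2 = V powr 2" using V0 by (simp add: powr_numeral)
    then have "(V\<^sup>2) powr (1 - exp (- \<rho> * t)) * V powr exp (- \<rho> * t)
        = V powr (2 * (1 - exp (- \<rho> * t))) * V powr exp (- \<rho> * t)"
      by (simp only: powr_powr)
    then show ?thesis unfolding powr_add[symmetric] by simp
  qed simp
  finally show ?thesis .
qed

end

section \<open>Optimising the time\<close>

lemma one_minus_exp_ge:
  fixes x :: real
  assumes "0 \<le> x" "x \<le> 1"
  shows "x / 2 \<le> 1 - exp (- x)"
proof -
  have "1 \<le> (1 - x / 2) * (1 + x)"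
    using mult_nonneg_nonneg[of x "1 - x"] assms by (simp add: field_simps)
  also have "\<dots> \<le> (1 - x / 2) * exp x" using assms by (intro mult_left_mono) auto
  finally show ?thesis by (simp add: exp_minus field_simps)
qed

lemma ex_dyadic:
  fixes y :: real
  assumes "1 \<le> y"
  shows "\<exists>k. 2 ^ k \<le> y \<and> y < 2 * 2 ^ k"
proof -
  obtain m :: nat where "y < 2 ^ m" using real_arch_pow[of 2 y] by auto
  then have ex: "\<exists>m. y < 2 ^ m" by blast
  define k where "k = (LEAST m. y < 2 ^ m)"
  have k: "y < 2 ^ k" unfolding k_def by (rule LeastI_ex[OF ex])
  then have "k \<noteq> 0" using assms by (cases "k = 0") auto
  then obtain j where j: "k = Suc j" by (cases k) auto
  have "\<not> y < 2 ^ j" using not_less_Least[of j "\<lambda>m. y < 2 ^ m"] j unfolding k_def by simp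
  then show ?thesis using k j by (intro exI[of _ j]) auto
qed

text \<open>
  The passage from the bounds on the decay of \<open>v\<close> to the final inequality, as a statement on real
  numbers. The cases are whether \<open>ln (1 / J)\<close> exceeds the threshold \<open>K * \<Lambda> / m\<close>. Above it,
  \<open>v T \<le> V * e\<^bsup>-y\<^esup>\<close> with \<open>y = m / 32 * ln (1 / J) \<ge> 1\<close>, and a dyadic fraction of \<open>T\<close> close to
  \<open>T / y\<close> is used. Below it, the target is at most a multiple of \<open>V * sqrt (\<rho> * m)\<close>, which the
  exponential decay up to time \<open>T\<close> gives.
\<close>

lemma optimise_time:
  fixes V J A \<rho> b C D :: real and v :: "real \<Rightarrow> real"
  defines "m \<equiv> min 1 \<rho>" and "\<Lambda> \<equiv> 1 + log_plus (1 / \<rho>)"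
    and "K \<equiv> 32 * (1 + ln (4 * D\<^sup>2 / b\<^sup>2))"
  assumes V: "0 < V" "V \<le> 1" and J: "0 < J" and \<rho>: "0 < \<rho>" and b: "0 < b" "b \<le> 1"
    and D: "1 \<le> D" and C: "0 < C" and A: "0 \<le> A"
    and v0: "\<And>t. 0 \<le> v t"
    and iso: "\<And>t. 0 \<le> t \<Longrightarrow> t \<le> 1 \<Longrightarrow> V - v (t / 2) \<le> C * sqrt t * A"
    and dyadic: "\<And>t k. v (t / 2 ^ k) ^ 2 ^ k \<le> V ^ (2 ^ k - 1) * v t"
    and decay: "\<And>t. 0 \<le> t \<Longrightarrow> v t \<le> exp (- \<rho> * t) * V"
    and small_set: "\<And>t. 0 \<le> t \<Longrightarrow> v t \<le> V powr (2 - exp (- \<rho> * t))"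
    and influences: "\<And>\<tau>. 0 < \<tau> \<Longrightarrow> \<tau> \<le> 1 / 2 \<Longrightarrow>
      \<rho> * \<tau> * b\<^sup>2 * v (2 * \<tau>) \<le> D\<^sup>2 * J powr (1 - exp (- \<rho> * \<tau>)) * V powr exp (- \<rho> * \<tau>)"
  shows "1 / (32 * C * sqrt (K + 2)) * (sqrt \<rho> * m / sqrt \<Lambda>) * V * sqrt (ln (1 + exp 1 / J)) \<le> A"
proof -
  define B where "B = 4 * D\<^sup>2 / b\<^sup>2"
  define \<tau> where "\<tau> = m / (4 * \<rho>)"
  define T where "T = 2 * \<tau>"
  define \<l> where "\<l> = ln (1 + exp 1 / J)"
  define y where "y = m / 32 * ln (1 / J)"
  have m: "0 < m" "m \<le> 1" "m \<le> \<rho>" unfolding m_def using \<rho> by auto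
  have B1: "1 \<le> B"
  proof -
    have "b\<^sup>2 \<le> 1" using b by (simp add: power_le_one)
    moreover have "1 \<le> D\<^sup>2" using D by (simp add: one_le_power)
    ultimately have "b\<^sup>2 \<le> 4 * D\<^sup>2" by linarith
    then show ?thesis unfolding B_def using b by simp
  qed
  have K: "K = 32 * (1 + ln B)" unfolding K_def B_def ..
  have lnB: "0 \<le> ln B" using B1 by simp
  have K32: "32 \<le> K" unfolding K using lnB by simp
  have ln_m: "ln (1 / m) = \<Lambda> - 1"
  proof (cases "\<rho> \<le> 1")
    case True
    then have "0 \<le> ln (1 / \<rho>)" using \<rho> by simp
    then show ?thesis using True by (simp add: m_def \<Lambda>_def log_plus_def)
  next
    case False
    then have "ln (1 / \<rho>) \<le> 0" using \<rho> by (simp add: ln_div)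
    then show ?thesis using False by (simp add: m_def \<Lambda>_def log_plus_def)
  qed
  have \<Lambda>: "1 \<le> \<Lambda>" unfolding \<Lambda>_def log_plus_def by simp
  have \<tau>: "0 < \<tau>" "\<tau> \<le> 1 / 4" "\<rho> * \<tau> = m / 4"
    unfolding \<tau>_def using m \<rho> by (auto simp: field_simps)
  have T: "0 < T" "2 * T \<le> 1" "\<rho> * T = m / 2" "2 * T = m / \<rho>"
    unfolding T_def using \<tau> by (auto simp: \<tau>_def)
  have l0: "0 \<le> \<l>" unfolding \<l>_def using J by (intro ln_ge_zero) simp
  have l_le: "\<l> \<le> max (ln (1 / J)) 0 + 2"
  proof -
    define Z where "Z = max (ln (1 / J)) 0"
    have "1 / J = exp (ln (1 / J))" using J by simp
    also have "\<dots> \<le> exp Z" unfolding Z_def by simp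
    finally have J': "1 / J \<le> exp Z" .
    have "1 + exp 1 / J = 1 + exp 1 * (1 / J)" by simp
    also have "\<dots> \<le> exp Z + exp 1 * exp Z"
      using J' by (intro add_mono mult_left_mono) (auto simp: Z_def)
    also have "\<dots> = exp Z * (1 + exp 1)" by (simp add: algebra_simps)
    also have "\<dots> \<le> exp Z * (exp 1 * exp 1)"
    proof (rule mult_left_mono)
      have "2 \<le> exp (1::real)" using exp_ge_add_one_self[of 1] by simp
      then have "2 * exp 1 \<le> exp 1 * exp (1::real)" by (intro mult_right_mono) auto
      then show "1 + exp 1 \<le> exp 1 * exp (1::real)" using \<open>2 \<le> exp 1\<close> by linarith
    qed simp
    also have "\<dots> = exp (Z + 2)" by (simp add: exp_add[symmetric])
    finally have "ln (1 + exp 1 / J) \<le> ln (exp (Z + 2))" using J by (intro ln_mono) (auto intro: add_pos_pos)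
    then show ?thesis unfolding \<l>_def Z_def by simp
  qed
  have target: "X \<le> 32 * C * sqrt (K + 2) * A \<Longrightarrow>
      1 / (32 * C * sqrt (K + 2)) * X \<le> A" for X
    using C K32 by (simp add: field_simps)
  have "sqrt \<rho> * m / sqrt \<Lambda> * V * sqrt \<l> \<le> 32 * C * sqrt (K + 2) * A"
  proof (cases "K * \<Lambda> / m \<le> ln (1 / J)")
    case False
    have "\<l> \<le> (K + 2) * \<Lambda> / m"
    proof -
      have "m * 1 \<le> 1 * \<Lambda>" using m \<Lambda> by (intro mult_mono) auto
      then have "2 \<le> 2 * \<Lambda> / m" using m by (simp add: field_simps)
      moreover have "0 \<le> K * \<Lambda> / m" using m \<Lambda> K32 by simp
      ultimately show ?thesis using l_le False by (simp add: add_divide_distrib distrib_right)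
    qed
    then have "sqrt \<l> \<le> sqrt (K + 2) * sqrt \<Lambda> / sqrt m"
      unfolding real_sqrt_mult[symmetric] real_sqrt_divide[symmetric] by simp
    then have "sqrt \<rho> * m / sqrt \<Lambda> * V * sqrt \<l>
        \<le> sqrt \<rho> * m / sqrt \<Lambda> * V * (sqrt (K + 2) * sqrt \<Lambda> / sqrt m)"
      using \<rho> m \<Lambda> V by (intro mult_left_mono) auto
    also have "\<dots> = sqrt (K + 2) * V * sqrt \<rho> * (m / sqrt m)" using \<Lambda> by simp
    also have "m / sqrt m = sqrt m" using m by (simp add: real_div_sqrt)
    finally have 1: "sqrt \<rho> * m / sqrt \<Lambda> * V * sqrt \<l> \<le> sqrt (K + 2) * (V * sqrt \<rho> * sqrt m)"
      by (simp add: mult_ac)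
    have "m / 4 * V \<le> (1 - exp (- (m / 2))) * V"
      using one_minus_exp_ge[of "m / 2"] m V by (intro mult_right_mono) auto
    also have "\<dots> \<le> V - v T"
    proof -
      have "v T \<le> exp (- (m / 2)) * V"
        using decay[OF less_imp_le[OF T(1)]] by (simp only: mult_minus_left T(3))
      then show ?thesis by (simp add: left_diff_distrib)
    qed
    also have "\<dots> \<le> C * sqrt (2 * T) * A" using iso[of "2 * T"] T(1,2) by simp
    also have "\<dots> = C * (sqrt m / sqrt \<rho>) * A" unfolding T(4) real_sqrt_divide ..
    finally have "m / 4 * V * (sqrt \<rho> / sqrt m) \<le> C * (sqrt m / sqrt \<rho>) * A * (sqrt \<rho> / sqrt m)"
      using m \<rho> by (intro mult_right_mono) auto
    also have "\<dots> = C * A" using m \<rho> by simp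
    also have "m / 4 * V * (sqrt \<rho> / sqrt m) = V * sqrt \<rho> * (m / sqrt m) / 4"
      by (simp add: mult_ac)
    also have "m / sqrt m = sqrt m" using m by (simp add: real_div_sqrt)
    finally have 2: "V * sqrt \<rho> * sqrt m \<le> 4 * C * A" by simp
    have "0 \<le> C * A" using C A by simp
    with 2 have "V * sqrt \<rho> * sqrt m \<le> 32 * C * A" by simp
    then have "sqrt (K + 2) * (V * sqrt \<rho> * sqrt m) \<le> sqrt (K + 2) * (32 * C * A)"
      using K32 by (intro mult_left_mono) auto
    with 1 show ?thesis by (simp add: mult_ac)
  next
    case True
    define \<l>J where "\<l>J = ln (1 / J)"
    have "1 * 1 \<le> (1 + ln B) * \<Lambda>" using lnB \<Lambda> by (intro mult_mono) auto
    moreover have y_ge: "(1 + ln B) * \<Lambda> \<le> y"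
      using True m unfolding y_def K by (simp add: field_simps)
    ultimately have y1: "1 \<le> y" by simp
    \<comment> \<open>The threshold is chosen so that half of the exponent \<open>2 * y\<close> absorbs the prefactor \<open>B / m\<close>
      of the bound by influences.\<close>
    have Bm: "B / m \<le> exp y"
    proof -
      have "ln (B / m) = ln B + \<Lambda> - 1" using ln_m m B1 by (simp add: ln_div)
      also have "\<dots> \<le> (1 + ln B) * \<Lambda>"
        using mult_left_mono[OF \<Lambda> lnB] by (simp add: algebra_simps)
      also have "\<dots> \<le> y" by (rule y_ge)
      finally have "exp (ln (B / m)) \<le> exp y" by simp
      then show ?thesis using m B1 by simp
    qed
    have lJ: "\<l>J = 32 * y / m" unfolding y_def \<l>J_def using m by simp
    have J_eq: "J = exp (- (32 * y / m))"
      using J unfolding lJ[symmetric] \<l>J_def by (simp add: ln_div)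
    \<comment> \<open>\<open>R\<close> is the square root of \<open>J\<close>. Either \<open>V \<le> R\<close> or \<open>J / V \<le> R\<close>, and each of the two bounds
      on \<open>v T\<close> handles one case, because \<open>R\<close> to the power \<open>m / 8\<close> is \<open>e\<close> to the power \<open>- 2 * y\<close>.\<close>
    define R where "R = exp (- (16 * y / m))"
    have R: "0 < R" "R \<le> 1" unfolding R_def using y1 m by auto
    have JR: "J = R * R" unfolding J_eq R_def exp_add[symmetric] by simp
    have R_powr: "R powr (m / 8) = exp (- (2 * y))" unfolding R_def powr_def using m by simp
    have vT: "v T \<le> V * exp (- y)"
    proof (cases "V \<le> R")
      case True
      have "v T \<le> V powr (2 - exp (- \<rho> * T))" using small_set T by simp
      also have "2 - exp (- \<rho> * T) = 1 + (1 - exp (- (m / 2)))" using T by simp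
      also have "V powr \<dots> = V * V powr (1 - exp (- (m / 2)))"
        using V by (simp only: powr_add) simp
      also have "\<dots> \<le> V * V powr (m / 8)"
        using one_minus_exp_ge[of "m / 2"] m V by (intro mult_left_mono powr_mono') auto
      also have "\<dots> \<le> V * R powr (m / 8)"
        using True V m by (intro mult_left_mono powr_mono2) auto
      also have "\<dots> \<le> V * exp (- y)" unfolding R_powr using V y1 by (intro mult_left_mono) auto
      finally show ?thesis .
    next
      case False
      define \<theta> where "\<theta> = 1 - exp (- (m / 4))"
      have \<theta>: "m / 8 \<le> \<theta>" unfolding \<theta>_def using one_minus_exp_ge[of "m / 4"] m by simp
      have JV: "J / V \<le> R"
      proof -
        have "J \<le> R * V" unfolding JR using False R by (intro mult_left_mono) auto
        then show ?thesis using V by (simp add: field_simps)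
      qed
      have "m / 4 * b\<^sup>2 * v T \<le> D\<^sup>2 * J powr \<theta> * V powr (1 - \<theta>)"
        using influences[of \<tau>] \<tau> unfolding T_def \<theta>_def by simp
      also have "\<dots> = D\<^sup>2 * (V * (J / V) powr \<theta>)"
        using V J by (simp add: powr_divide powr_diff)
      also have "\<dots> \<le> D\<^sup>2 * (V * R powr (m / 8))"
      proof (intro mult_left_mono)
        have "(J / V) powr \<theta> \<le> R powr \<theta>" using JV J V m \<theta> by (intro powr_mono2) auto
        also have "\<dots> \<le> R powr (m / 8)" using R \<theta> by (intro powr_mono') auto
        finally show "(J / V) powr \<theta> \<le> R powr (m / 8)" .
      qed (use V in auto)
      finally have "v T \<le> B / m * (V * exp (- (2 * y)))"
        unfolding R_powr B_def using m b by (simp add: field_simps)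
      also have "\<dots> \<le> exp y * (V * exp (- (2 * y)))"
        using Bm V by (intro mult_right_mono) auto
      also have "\<dots> = V * exp (- y)" by (simp add: exp_add[symmetric] mult.left_commute)
      finally show ?thesis .
    qed
    obtain k where k: "2 ^ k \<le> y" "y < 2 * 2 ^ k" using ex_dyadic[OF y1] by blast
    have "v (T / 2 ^ k) ^ 2 ^ k \<le> V ^ (2 ^ k - 1) * (V * exp (- y))"
      using V by (intro order_trans[OF dyadic] mult_left_mono vT) auto
    also have "\<dots> = V ^ 2 ^ k * exp (- y)"
      using power_minus_mult[of "2 ^ k" V] by (simp add: mult.assoc[symmetric])
    also have "\<dots> \<le> V ^ 2 ^ k * exp (-1) ^ 2 ^ k"
      unfolding exp_of_nat_mult[symmetric] using k V by (intro mult_left_mono) auto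
    also have "\<dots> = (V * exp (-1)) ^ 2 ^ k" by (simp add: power_mult_distrib)
    finally have "v (T / 2 ^ k) \<le> V * exp (-1)"
      using V by (subst (asm) power_mono_iff) (auto intro: v0)
    also have "\<dots> \<le> V * (1 / 2)"
    proof (rule mult_left_mono)
      have "2 \<le> exp (1::real)" using exp_ge_add_one_self[of 1] by simp
      then show "exp (-1) \<le> (1 / 2 :: real)" by (simp add: exp_minus field_simps)
    qed (use V in simp)
    finally have "V / 2 \<le> V - v (T / 2 ^ k)" by simp
    also have "\<dots> \<le> C * sqrt (2 * T / 2 ^ k) * A"
    proof -
      have "2 * T / 2 ^ k \<le> 1 / 1" using T by (intro frac_le) auto
      then show ?thesis using iso[of "2 * T / 2 ^ k"] T(1) by simp
    qed
    also have "\<dots> \<le> C * sqrt (64 / (\<rho> * \<l>J)) * A"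
    proof (intro mult_right_mono mult_left_mono real_sqrt_le_mono)
      have "2 * T / 2 ^ k \<le> 2 * T / (y / 2)" using T k y1 by (intro divide_left_mono) auto
      also have "\<dots> = 64 / (\<rho> * \<l>J)" unfolding T(4) lJ using m \<rho> y1 by (simp add: field_simps)
      finally show "2 * T / 2 ^ k \<le> 64 / (\<rho> * \<l>J)" .
    qed (use A C in auto)
    finally have half: "V / 2 \<le> C * sqrt (64 / (\<rho> * \<l>J)) * A" .
    have lJ1: "1 \<le> \<l>J"
    proof -
      have "m * 1 \<le> 1 * (32 * y)" using m y1 by (intro mult_mono) auto
      then show ?thesis unfolding lJ using m by (simp add: field_simps)
    qed
    have "sqrt (64 / (\<rho> * \<l>J)) = 8 / (sqrt \<rho> * sqrt \<l>J)"
      using real_sqrt_abs[of 8] by (simp add: real_sqrt_divide real_sqrt_mult)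
    with half have "V / 2 \<le> C * (8 / (sqrt \<rho> * sqrt \<l>J)) * A" by (simp only:)
    then have main: "V * sqrt \<rho> * sqrt \<l>J \<le> 16 * C * A"
      using \<rho> lJ1 by (simp add: field_simps)
    have "m / sqrt \<Lambda> \<le> 1 / 1" using m \<Lambda> by (intro frac_le) auto
    then have "sqrt \<rho> * (m / sqrt \<Lambda>) * V * sqrt \<l> \<le> sqrt \<rho> * 1 * V * sqrt (4 * \<l>J)"
      using l_le lJ1 \<rho> V l0 m \<Lambda>
      by (intro mult_mono real_sqrt_le_mono) (auto simp: \<l>J_def)
    also have "\<dots> = 2 * (V * sqrt \<rho> * sqrt \<l>J)" by (simp add: real_sqrt_mult)
    also have "\<dots> \<le> 32 * C * 1 * A" using main by linarith
    also have "\<dots> \<le> 32 * C * sqrt (K + 2) * A"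
      using K32 C A by (intro mult_right_mono mult_left_mono) auto
    finally show ?thesis by simp
  qed
  then show ?thesis using target[of "sqrt \<rho> * m / sqrt \<Lambda> * V * sqrt \<l>"] unfolding \<l>_def by (simp add: mult.assoc)
qed

theorem theorem5p7:
  fixes b \<rho>\<^sub>C :: real
  assumes "0 < b" and "b \<le> 1"
  shows "\<exists>c>0. \<forall>(n::nat) (\<mu> :: point pmf) (q :: vfield) (w :: vfield) (\<rho>\<^sub>L :: real) (f :: point \<Rightarrow> real).
    distribution_on_cube n \<mu> \<longrightarrow>
    transition_rates n q \<longrightarrow>
    reversible n \<mu> q \<longrightarrow>
    bounded_weights n b w \<longrightarrow>
    CSGE_0 n q w \<rho>\<^sub>C \<longrightarrow>
    CSGE_inf n \<mu> q w \<rho>\<^sub>C \<longrightarrow>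
    0 < \<rho>\<^sub>L \<longrightarrow>
    log_sobolev n \<mu> q \<rho>\<^sub>L \<longrightarrow>
    (\<forall>x\<in>cube n. f x \<in> {-1, 1}) \<longrightarrow>
    A_fun n \<mu> q w f
      \<ge> c * (sqrt \<rho>\<^sub>L * min 1 \<rho>\<^sub>L / sqrt (1 + log_plus (1 / \<rho>\<^sub>L)))
          * measure_pmf.variance \<mu> f * sqrt (ln (1 + exp 1 / J_fun n \<mu> q w f))"
proof -
  define C where "C = 2 * exp \<bar>\<rho>\<^sub>C\<bar> / (b * sqrt (2 * b))"
  define D where "D = exp (2 * \<bar>\<rho>\<^sub>C\<bar>)"
  define K where "K = 32 * (1 + ln (4 * D\<^sup>2 / b\<^sup>2))"
  have C: "0 < C" unfolding C_def using assms by simp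
  have D: "1 \<le> D" unfolding D_def by simp
  have "b\<^sup>2 \<le> 1" using assms by (simp add: power_le_one)
  moreover have "1 \<le> D\<^sup>2" using D by (simp add: one_le_power)
  ultimately have "b\<^sup>2 \<le> 4 * D\<^sup>2" by linarith
  then have "0 \<le> ln (4 * D\<^sup>2 / b\<^sup>2)" using assms by (intro ln_ge_zero) simp
  then have K: "0 < K + 2" unfolding K_def by simp
  show ?thesis
  proof (intro exI[of _ "1 / (32 * C * sqrt (K + 2))"] conjI allI impI)
    show "0 < 1 / (32 * C * sqrt (K + 2))" using C K by simp
  next
    fix n :: nat and \<mu> :: "point pmf" and q w :: vfield and \<rho>\<^sub>L :: real and f :: "point \<Rightarrow> real"
    assume hyps: "distribution_on_cube n \<mu>" "transition_rates n q" "reversible n \<mu> q"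
        "bounded_weights n b w"
      and csge0: "CSGE_0 n q w \<rho>\<^sub>C" and csge: "CSGE_inf n \<mu> q w \<rho>\<^sub>C"
      and \<rho>: "0 < \<rho>\<^sub>L" and lsi: "log_sobolev n \<mu> q \<rho>\<^sub>L"
      and f: "\<forall>x\<in>cube n. f x \<in> {-1, 1}"
    interpret weighted_cube n q \<mu> w b
      by unfold_locales (use hyps assms in auto)
    define g where "g = (\<lambda>x. f x - E f)"
    define v where "v t = E (\<lambda>x. (P t g x)\<^sup>2)" for t
    define V where "V = E (\<lambda>x. (g x)\<^sup>2)"
    define J where "J = J_fun n \<mu> q w f"
    have f2: "(f x)\<^sup>2 \<le> 1" if "x \<in> cube n" for x using f that by auto
    have Eg: "E g = 0" unfolding g_def E_diff E_const by simp
    have V_eq: "V = E (\<lambda>x. (f x)\<^sup>2) - (E f)\<^sup>2"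
      using centered_energy[of 0 f] by (simp add: V_def g_def semigroup_0)
    have "E (\<lambda>x. (f x)\<^sup>2) \<le> E (\<lambda>_. 1)" by (intro E_mono f2)
    then have V1: "V \<le> 1"
      unfolding V_eq E_const using zero_le_power2[of "E f"] by linarith
    have V0: "0 \<le> V" unfolding V_def by (intro E_nonneg) auto
    have J0: "0 \<le> J" unfolding J_def J_fun_eq by (intro sum_nonneg) auto
    have A0: "0 \<le> A_fun n \<mu> q w f" unfolding A_fun_eq by (intro E_nonneg) auto
    have Jg: "J_fun n \<mu> q w g = J" unfolding J_def J_fun_def grad_def g_def by simp
    have var: "measure_pmf.variance \<mu> f = V"
      unfolding V_def g_def expectation_eq_E ..
    show "A_fun n \<mu> q w f
      \<ge> 1 / (32 * C * sqrt (K + 2)) * (sqrt \<rho>\<^sub>L * min 1 \<rho>\<^sub>L / sqrt (1 + log_plus (1 / \<rho>\<^sub>L)))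
          * measure_pmf.variance \<mu> f * sqrt (ln (1 + exp 1 / J_fun n \<mu> q w f))"
    \<comment> \<open>For \<open>J = 0\<close> the quotient \<open>exp 1 / J\<close> is \<open>0\<close> by convention, so the right-hand side vanishes.\<close>
    proof (cases "V = 0 \<or> J = 0")
      case True
      then show ?thesis unfolding var J_def[symmetric] using A0 by auto
    next
      case False
      show ?thesis
        unfolding var J_def[symmetric] K_def
      proof (rule optimise_time[where v = v])
        fix t :: real assume t: "0 \<le> t" "t \<le> 1"
        have "V - v (t / 2) = E (\<lambda>x. (f x)\<^sup>2) - E (\<lambda>x. f x * P t f x)"
          using E_mult_semigroup_double[of f "t / 2"] centered_energy[of "t / 2" f]
          unfolding V_eq v_def g_def by simp
        then show "V - v (t / 2) \<le> C * sqrt t * A_fun n \<mu> q w f"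
          using noise_stability_ge[OF csge0 t f2] unfolding C_def by simp
      next
        fix t :: real and k
        show "v (t / 2 ^ k) ^ 2 ^ k \<le> V ^ (2 ^ k - 1) * v t"
          unfolding v_def V_def by (rule energy_dyadic)
      next
        fix t :: real assume "0 \<le> t"
        then show "v t \<le> exp (- \<rho>\<^sub>L * t) * V"
          unfolding v_def V_def by (intro variance_decay lsi \<rho> Eg)
      next
        fix t :: real assume "0 \<le> t"
        then show "v t \<le> V powr (2 - exp (- \<rho>\<^sub>L * t))"
          unfolding v_def
          by (rule sign_function_energy_le[OF lsi \<rho>]) (use f in \<open>auto simp: g_def V_def\<close>)
      next
        fix \<tau> :: real assume "0 < \<tau>" "\<tau> \<le> 1 / 2"
        from energy_le_J[OF csge0 csge lsi \<rho> this Eg]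
        show "\<rho>\<^sub>L * \<tau> * b\<^sup>2 * v (2 * \<tau>)
            \<le> D\<^sup>2 * J powr (1 - exp (- \<rho>\<^sub>L * \<tau>)) * V powr exp (- \<rho>\<^sub>L * \<tau>)"
          unfolding v_def V_def D_def Jg .
      qed (use False V0 V1 J0 A0 C D \<rho> assms in \<open>auto simp: v_def intro!: E_nonneg\<close>)
    qed
  qed
qed

end
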